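(* Let $\alpha=2$, $f_0,f_1>0$, and let $\nu$ be a compactly supported probability measure on $\mathbb{R}$ with $\#(\operatorname{supp}\nu)\ge5$. Then the Lyapunov exponent satisfies $L(E)>0$ for every $E\in\mathbb{R}$.
   Context: Lyapunov exponent of the generalized Anderson model (with $V_0\equiv0$): for $E,\lambda\in\mathbb{R}$ let $T_i(\lambda,E)=\begin{pmatrix}E-f_i\lambda&-1\\1&0\end{pmatrix}$ and let the $\alpha$-step transfer matrix be $M_\lambda(E)=T_{\alpha-1}(\lambda,E)\cdots T_0(\lambda,E)\in SL(2,\mathbb{R})$. Let $\lambda_1,\lambda_2,\dots$ be i.i.d. with law $\nu$. Then $L(E)=\lim_{n\to\infty}\frac1n\log\|M_{\lambda_n}(E)\cdots M_{\lambda_1}(E)\|$, which exists and is almost surely constant. *)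

theory Defs
  imports "HOL-Probability.Probability"
begin

definition transfer :: "real \<Rightarrow> real \<Rightarrow> real \<Rightarrow> real^2^2" where
  "transfer f lam E = vector [vector [E - f * lam, -1], vector [1, 0]]"

text \<open>alpha-step transfer matrix M_lambda(E) = T_{alpha-1} ... T_0, for a list fs = [f_0,...,f_{alpha-1}].\<close>
definition block_transfer :: "real list \<Rightarrow> real \<Rightarrow> real \<Rightarrow> real^2^2" where
  "block_transfer fs lam E = foldl (\<lambda>A f. transfer f lam E ** A) (mat 1) fs"

text \<open>Random product M_{lam(n-1)}(E) ... M_{lam 0}(E) (indices shifted to start at 0).\<close>
fun rand_prod :: "real list \<Rightarrow> (nat \<Rightarrow> real) \<Rightarrow> real \<Rightarrow> nat \<Rightarrow> real^2^2" where
  "rand_prod fs lam E 0 = mat 1"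
| "rand_prod fs lam E (Suc n) = block_transfer fs (lam n) E ** rand_prod fs lam E n"

definition mnorm :: "real^2^2 \<Rightarrow> real" where
  "mnorm A = onorm (\<lambda>x. A *v x)"

definition msupp :: "real measure \<Rightarrow> real set" where
  "msupp \<nu> = {x. \<forall>U. open U \<longrightarrow> x \<in> U \<longrightarrow> emeasure \<nu> U > 0}"

end

theory Submission
  imports Defs
begin

text \<open>
  Identify the plane with the complex numbers and let \<open>Q g x\<close> be the mean of \<open>g (A l x)\<close> under \<open>\<nu>\<close>,
  where \<open>A l\<close> is the two-step transfer matrix.

  Positivity: if for every \<open>n\<close> some \<open>x\<close> had \<open>Q^n ln|x| \<le> ln|x|\<close>, Cesaro averages of the laws of the
  directions would accumulate at a stationary measure \<open>\<mu>\<close> on the circle with nonpositive mean drift.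
  If \<open>\<mu>\<close> gives every line mass less than 1/2, the mean \<open>\<Psi>\<close> of \<open>ln S\<close> under \<open>\<mu>\<close> is a proper strictly
  convex function of the form \<open>S\<close> in the hyperbolic plane of quadratic forms of determinant 1; its
  average over the walk does not exceed its value, so its unique minimum is a form invariant under
  all \<open>A l\<close>. Otherwise the at most two lines of maximal mass are permuted by all \<open>A l\<close>. Either
  conclusion is a quadratic condition on \<open>l\<close> (two of them in the second case), so it cannot hold at
  five points.

  Convergence: positivity yields a corrected logarithm \<open>W\<close> with drift bounded below, so \<open>Q\<close>
  contracts a Hoelder seminorm on the projective line and \<open>Q^n\<close> of the drift tends uniformly to a
  constant \<open>L > 0\<close>. With \<open>u = Q^n ln\<close> the drift of \<open>u\<close> is nearly constant, and exponential moments of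
  \<open>u\<close> together with the Borel-Cantelli lemma give the almost sure limit.
\<close>

section \<open>Averaging over a family of unimodular maps\<close>

text \<open>Pulling back a form of determinant 1 along a map of determinant 1 gives another such
  form, so the family acts on the hyperbolic plane of these forms. For a direction \<open>x\<close>,
  \<open>ln S(x)\<close> is the Busemann function of the corresponding boundary point, so the
  minimiser is the barycentre of \<open>\<mu>\<close>. This explains the threshold 1/2: towards a
  boundary point of mass \<open>m\<close> the mean \<open>\<Psi>\<close> behaves like
  \<open>(1 - 2 * m) * ln |q|\<close>. The drift enters because \<open>ln S(x) - 2 * ln |x|\<close>
  depends only on the direction of \<open>x\<close>: stationarity applies to this difference, and
  the rest contributes exactly twice the mean drift.

  The obstacle in the convergence part is that the one-step drift of \<open>ln |x|\<close> may be
  negative in some directions; positivity holds only after a fixed number of steps, uniformly in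
  \<open>x\<close>. Hence the correction of the logarithm by a bounded function of the direction.
  Existence of the limit is not taken from subadditivity: existence and positivity both come from
  the uniform limit of \<open>Q^n\<close> of the drift.\<close>

lemma AE_msupp:
  assumes "sets \<nu> = sets borel"
  shows "AE l in \<nu>. l \<in> msupp \<nu>"
proof -
  \<comment> \<open>The complement of the support is a union of null open sets; by Lindelof
    countably many of them suffice.\<close>
  define F where "F = {U::real set. open U \<and> emeasure \<nu> U = 0}"
  obtain F' where F': "F' \<subseteq> F" "countable F'" "\<Union>F' = \<Union>F"
    using Lindelof[of F] unfolding F_def by auto
  have "(\<Union>U\<in>F'. U) \<in> null_sets \<nu>"
  proof (rule null_sets_UN')
    show "countable F'" by fact
    fix U assume "U \<in> F'"
    then have "open U" "emeasure \<nu> U = 0" using F' unfolding F_def by auto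
    then show "U \<in> null_sets \<nu>" using assms by (auto simp: null_sets_def)
  qed
  then have "\<Union>F \<in> null_sets \<nu>" using F' by simp
  moreover have "\<Union>F = - msupp \<nu>"
    unfolding F_def msupp_def by (auto simp: not_gr_zero)
  ultimately have "AE l in \<nu>. l \<notin> - msupp \<nu>" using AE_not_in by metis
  then show ?thesis by simp
qed

text \<open>Upgrades an almost sure condition that is closed in \<open>l\<close> to every point of
  the support, which is what makes counting roots possible.\<close>

lemma msupp_subset_closed:
  assumes "sets \<nu> = sets borel" "closed G" "AE l in \<nu>. l \<in> G"
  shows "msupp \<nu> \<subseteq> G"
proof
  fix x assume x: "x \<in> msupp \<nu>"
  show "x \<in> G"
  proof (rule ccontr)
    assume "x \<notin> G"
    then have "emeasure \<nu> (- G) > 0" using x assms(2) unfolding msupp_def by (auto simp: open_Compl)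
    moreover have "- G \<in> null_sets \<nu>"
    proof (rule AE_iff_null_sets[THEN iffD2])
      show "- G \<in> sets \<nu>" using assms by auto
      show "AE x in \<nu>. x \<notin> - G" using assms(3) by simp
    qed
    ultimately show False by auto
  qed
qed

text \<open>The area form, i.e. the determinant of the pair. Its invariance expresses determinant 1
  without matrices, and its vanishing expresses that two nonzero vectors span the same line.\<close>

definition wedge :: "complex \<Rightarrow> complex \<Rightarrow> real" where
  "wedge x y = Re x * Im y - Im x * Re y"

lemma continuous_on_wedge [continuous_intros]:
  "continuous_on S f \<Longrightarrow> continuous_on S g \<Longrightarrow> continuous_on S (\<lambda>t. wedge (f t) (g t))"
  unfolding wedge_def by (intro continuous_intros)

lemma wedge_mult_left [simp]: "wedge (of_real t * x) y = t * wedge x y"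
  and wedge_mult_right [simp]: "wedge x (of_real t * y) = t * wedge x y"
  and wedge_self [simp]: "wedge x x = 0"
  by (simp_all add: wedge_def algebra_simps)

lemma wedge_commute: "wedge x y = - wedge y x"
  by (simp add: wedge_def)

lemma wedge_i_times: "wedge x (\<i> * x) = (cmod x)\<^sup>2"
  by (simp add: wedge_def cmod_power2) (simp add: power2_eq_square)

lemma wedge_squared: "(wedge x y)\<^sup>2 = (cmod x)\<^sup>2 * (cmod y)\<^sup>2 - (x \<bullet> y)\<^sup>2"
  by (simp add: wedge_def cmod_power2 inner_complex_def) algebra

lemma abs_wedge_le: "\<bar>wedge x y\<bar> \<le> cmod x * cmod y"
proof (rule power2_le_imp_le)
  show "\<bar>wedge x y\<bar>\<^sup>2 \<le> (cmod x * cmod y)\<^sup>2"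
    by (simp add: wedge_squared power_mult_distrib)
qed simp

lemma wedge_eq_0D:
  assumes "wedge x y = 0" "x \<noteq> 0"
  obtains t where "y = of_real t * x"
proof
  have n: "(cmod x)\<^sup>2 \<noteq> 0" using assms by simp
  have w: "Re x * Im y = Im x * Re y" using assms(1) by (simp add: wedge_def)
  have "(cmod x)\<^sup>2 * Re y = (x \<bullet> y) * Re x" "(cmod x)\<^sup>2 * Im y = (x \<bullet> y) * Im x"
    using w by (simp_all add: inner_complex_def cmod_power2) algebra+
  then show "y = of_real ((x \<bullet> y) / (cmod x)\<^sup>2) * x"
    using n by (auto simp: complex_eq_iff field_simps)
qed

lemma wedge_zero_trans:
  assumes "x \<noteq> 0" "y \<noteq> 0" "wedge x y = 0"
  shows "wedge z x = 0 \<longleftrightarrow> wedge z y = 0"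
proof -
  obtain t where "y = of_real t * x" using wedge_eq_0D assms by metis
  then show ?thesis using assms by auto
qed

abbreviation cont_off_0 :: "(complex \<Rightarrow> real) \<Rightarrow> bool" where
  "cont_off_0 g \<equiv> continuous_on (-{0}) g"

text \<open>Together with \<open>cont_off_0\<close> this encodes continuous functions on the
  projective line as functions on the punctured plane; negative \<open>t\<close> is included, and
  the value at 0 carries no information.\<close>

definition homog0 :: "(complex \<Rightarrow> real) \<Rightarrow> bool" where
  "homog0 g \<longleftrightarrow> (\<forall>t x. t \<noteq> 0 \<longrightarrow> g (of_real t * x) = g x)"

lemma homog0_sgn:
  assumes "homog0 g" "x \<noteq> 0" shows "g (sgn x) = g x"
proof -
  have "sgn x = of_real (1 / cmod x) * x"
    using assms by (simp add: sgn_div_norm scaleR_conv_of_real field_simps)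
  moreover have "1 / cmod x \<noteq> 0" using assms by simp
  ultimately show ?thesis using assms unfolding homog0_def by metis
qed

lemma homog0_bounded:
  assumes "cont_off_0 g" "homog0 g"
  obtains B where "\<And>x. x \<noteq> 0 \<Longrightarrow> \<bar>g x\<bar> \<le> B"
proof -
  have "compact (g ` sphere 0 1)"
    by (intro compact_continuous_image continuous_on_subset[OF assms(1)]) auto
  then obtain B where B: "\<And>y. y \<in> g ` sphere 0 1 \<Longrightarrow> norm y \<le> B"
    using compact_imp_bounded bounded_iff by metis
  have "\<bar>g x\<bar> \<le> B" if "x \<noteq> 0" for x
  proof -
    have "sgn x \<in> sphere 0 1" using that by (simp add: norm_sgn)
    then have "norm (g (sgn x)) \<le> B" using B by blast
    then show ?thesis using homog0_sgn[OF assms(2) that] by simp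
  qed
  then show ?thesis using that by blast
qed

lemma homog0_attains_inf:
  assumes "cont_off_0 g" "homog0 g"
  obtains x0 where "x0 \<noteq> 0" "\<And>x. x \<noteq> 0 \<Longrightarrow> g x0 \<le> g x"
proof -
  have "continuous_on (sphere 0 1) g" by (intro continuous_on_subset[OF assms(1)]) auto
  moreover have "sphere 0 1 \<noteq> ({}::complex set)" by simp
  ultimately obtain x0 where x0: "x0 \<in> sphere 0 1" "\<And>y. y \<in> sphere 0 1 \<Longrightarrow> g x0 \<le> g y"
    using continuous_attains_inf[OF compact_sphere] by metis
  show ?thesis
  proof (rule that)
    show "x0 \<noteq> 0" using x0 by auto
    fix x :: complex assume "x \<noteq> 0"
    then show "g x0 \<le> g x" using x0(2)[of "sgn x"] homog0_sgn[OF assms(2)] by (auto simp: norm_sgn)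
  qed
qed

lemma cont_off_0_measurable:
  assumes "cont_off_0 g" shows "g \<in> borel_measurable borel"
proof -
  have "(\<lambda>x. if x \<in> -{0} then g x else g 0) \<in> borel_measurable borel"
    using assms by (intro borel_measurable_continuous_on_if) auto
  moreover have "(\<lambda>x. if x \<in> -{0} then g x else g 0) = g" by auto
  ultimately show ?thesis by simp
qed

lemma cont_off_0_ln_cmod: "cont_off_0 (\<lambda>x. ln (cmod x))"
  by (intro continuous_intros) auto

locale sl2_family =
  fixes \<nu> :: "real measure" and A :: "real \<Rightarrow> complex \<Rightarrow> complex"
  assumes prob_nu: "prob_space \<nu>" and sets_nu: "sets \<nu> = sets borel"
    and compact_msupp: "compact (msupp \<nu>)"
    and linear_A: "linear (A l)"
    and wedge_A: "wedge (A l x) (A l y) = wedge x y"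
    and continuous_A: "continuous_on UNIV (\<lambda>p. A (fst p) (snd p))"
begin

sublocale prob_space \<nu> by (rule prob_nu)

lemma space_nu [simp]: "space \<nu> = UNIV"
  using sets_eq_imp_space_eq[OF sets_nu] by simp

lemma prob_UNIV [simp]: "prob UNIV = 1"
  using prob_space by simp

lemma measurable_nu_iff [simp]: "f \<in> measurable \<nu> N \<longleftrightarrow> f \<in> measurable borel N"
  by (simp add: measurable_cong_sets[OF sets_nu refl])

lemma AE_in_msupp: "AE l in \<nu>. l \<in> msupp \<nu>"
  by (rule AE_msupp[OF sets_nu])

lemma A_mult: "A l (of_real t * x) = of_real t * A l x"
  using linear_A[of l] linear_scale[of "A l" t x] by (simp add: scaleR_conv_of_real)

lemma A_0 [simp]: "A l 0 = 0"
  using linear_A linear_0 by blast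

lemma A_eq_0_iff [simp]: "A l x = 0 \<longleftrightarrow> x = 0"
proof
  assume "A l x = 0"
  then have "wedge x (\<i> * x) = 0" using wedge_A[of l x "\<i> * x"] by (simp add: wedge_def)
  then show "x = 0" by (simp add: wedge_i_times)
qed simp

lemma A_eq: "A l x = of_real (Re x) * A l 1 + of_real (Im x) * A l \<i>"
proof -
  have "A l x = A l (of_real (Re x) * 1 + of_real (Im x) * \<i>)"
    by (rule arg_cong[of _ _ "A l"]) (simp add: complex_eq_iff)
  also have "\<dots> = A l (of_real (Re x) * 1) + A l (of_real (Im x) * \<i>)"
    using linear_A linear_add by blast
  also have "\<dots> = of_real (Re x) * A l 1 + of_real (Im x) * A l \<i>"
    by (simp only: A_mult)
  finally show ?thesis .
qed

lemma continuous_on_A [continuous_intros]: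
  assumes "continuous_on S f" "continuous_on S g"
  shows "continuous_on S (\<lambda>t. A (f t) (g t))"
  using continuous_on_compose2[OF continuous_A continuous_on_Pair[OF assms]] by simp

lemma measurable_A:
  assumes [measurable]: "f \<in> borel_measurable N" "g \<in> borel_measurable N"
  shows "(\<lambda>t. A (f t) (g t)) \<in> borel_measurable N"
proof -
  have "(\<lambda>p. A (fst p) (snd p)) \<in> borel_measurable borel"
    by (rule borel_measurable_continuous_onI[OF continuous_A])
  then have "(\<lambda>p. A (fst p) (snd p)) \<in> borel_measurable (borel \<Otimes>\<^sub>M borel)"
    by (simp add: borel_prod)
  from measurable_compose[OF measurable_Pair[OF assms] this] show ?thesis by simp
qed

lemma A_bounds:
  obtains C where "C \<ge> 1" "\<And>l x. l \<in> msupp \<nu> \<Longrightarrow> cmod (A l x) \<le> C * cmod x"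
    "\<And>l x. l \<in> msupp \<nu> \<Longrightarrow> cmod x \<le> C * cmod (A l x)"
proof -
  have "compact ((\<lambda>l. cmod (A l 1) + cmod (A l \<i>)) ` msupp \<nu>)"
    by (intro compact_continuous_image continuous_intros compact_msupp)
  then obtain B where B: "\<And>y. y \<in> (\<lambda>l. cmod (A l 1) + cmod (A l \<i>)) ` msupp \<nu> \<Longrightarrow> norm y \<le> B"
    using compact_imp_bounded bounded_iff by metis
  define C where "C = max B 1"
  have up: "cmod (A l x) \<le> C * cmod x" if "l \<in> msupp \<nu>" for l x
  proof -
    have "cmod (A l x) \<le> \<bar>Re x\<bar> * cmod (A l 1) + \<bar>Im x\<bar> * cmod (A l \<i>)"
      by (subst A_eq) (rule order_trans[OF norm_triangle_ineq], simp add: norm_mult)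
    also have "\<dots> \<le> cmod x * cmod (A l 1) + cmod x * cmod (A l \<i>)"
      by (intro add_mono mult_right_mono abs_Re_le_cmod abs_Im_le_cmod) auto
    also have "\<dots> = (cmod (A l 1) + cmod (A l \<i>)) * cmod x" by (simp add: algebra_simps)
    also have "\<dots> \<le> C * cmod x"
      using B[of "cmod (A l 1) + cmod (A l \<i>)"] that unfolding C_def
      by (intro mult_right_mono) auto
    finally show ?thesis .
  qed
  have "cmod x \<le> C * cmod (A l x)" if l: "l \<in> msupp \<nu>" for l x
  proof (cases "x = 0")
    case False
    \<comment> \<open>Determinant 1 turns the upper bound into a lower one: the area spanned by
      \<open>x\<close> and \<open>\<i> * x\<close> is preserved, while the image of
      \<open>\<i> * x\<close> has length at most \<open>C * cmod x\<close>.\<close>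
    have "(cmod x)\<^sup>2 = wedge (A l x) (A l (\<i> * x))" by (simp add: wedge_A wedge_i_times)
    also have "\<dots> \<le> cmod (A l x) * cmod (A l (\<i> * x))" using abs_wedge_le abs_le_iff by blast
    also have "\<dots> \<le> cmod (A l x) * (C * cmod (\<i> * x))"
      by (intro mult_left_mono up l) auto
    finally have "cmod x * cmod x \<le> (C * cmod (A l x)) * cmod x"
      by (simp add: norm_mult power2_eq_square algebra_simps)
    then show ?thesis using False by simp
  qed simp
  then show ?thesis using that[of C] up C_def by auto
qed

lemma bounded_on_compact:
  assumes "cont_off_0 g" "compact X" "0 \<notin> X"
  obtains B where "\<And>l x. l \<in> msupp \<nu> \<Longrightarrow> x \<in> X \<Longrightarrow> \<bar>g (A l x)\<bar> \<le> B"
proof -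
  have "compact ((\<lambda>p. g (A (fst p) (snd p))) ` (msupp \<nu> \<times> X))"
  proof (intro compact_continuous_image compact_Times compact_msupp assms)
    show "continuous_on (msupp \<nu> \<times> X) (\<lambda>p. g (A (fst p) (snd p)))"
      by (rule continuous_on_compose2[OF assms(1)]) (use assms in \<open>auto intro!: continuous_intros\<close>)
  qed
  then obtain B where "\<And>y. y \<in> (\<lambda>p. g (A (fst p) (snd p))) ` (msupp \<nu> \<times> X) \<Longrightarrow> norm y \<le> B"
    using compact_imp_bounded bounded_iff by metis
  then show ?thesis using that[of B] by force
qed

lemma measurable_cont_off_0_A:
  assumes "cont_off_0 g" shows "(\<lambda>l. g (A l x)) \<in> borel_measurable borel"
  by (rule measurable_compose[OF measurable_A cont_off_0_measurable[OF assms]]) simp_all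

lemma integrable_cont_off_0:
  assumes "cont_off_0 g" shows "integrable \<nu> (\<lambda>l. g (A l x))"
proof (cases "x = 0")
  case False
  then obtain B where "\<And>l. l \<in> msupp \<nu> \<Longrightarrow> \<bar>g (A l x)\<bar> \<le> B"
    using bounded_on_compact[OF assms, of "{x}"]
    by (metis Compl_iff compact_sing singletonD singletonI)
  then show ?thesis
    using AE_in_msupp measurable_cont_off_0_A[OF assms]
    by (intro integrable_const_bound[where B = B]) auto
qed simp

text \<open>The transition operator of the Markov chain of positions. It is applied to functions of
  the direction and to \<open>ln (cmod x)\<close> alike, so it is defined on functions on the
  plane.\<close>

definition Q :: "(complex \<Rightarrow> real) \<Rightarrow> complex \<Rightarrow> real" where
  "Q g x = (\<integral>l. g (A l x) \<partial>\<nu>)"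

lemma cont_off_0_Q:
  assumes "cont_off_0 g" shows "cont_off_0 (Q g)"
proof (unfold continuous_on_sequentially, intro ballI allI impI)
  fix f :: "nat \<Rightarrow> complex" and a
  assume a: "a \<in> - {0}" and f: "(\<forall>n. f n \<in> - {0}) \<and> f \<longlonglongrightarrow> a"
  \<comment> \<open>A convergent sequence together with its limit is a compact set avoiding 0, which
    yields one dominating constant for all \<open>n\<close>.\<close>
  have "compact (insert a (range f))" using f compact_sequence_with_limit by blast
  then obtain B where B: "\<And>l x. l \<in> msupp \<nu> \<Longrightarrow> x \<in> insert a (range f) \<Longrightarrow> \<bar>g (A l x)\<bar> \<le> B"
    using bounded_on_compact[OF assms] a f by (metis ComplD imageE insertE singletonI)
  have "(\<lambda>n. \<integral>l. g (A l (f n)) \<partial>\<nu>) \<longlonglongrightarrow> (\<integral>l. g (A l a) \<partial>\<nu>)"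
  proof (rule integral_dominated_convergence[where w = "\<lambda>_. B"])
    have "(\<lambda>n. g (A l (f n))) \<longlonglongrightarrow> g (A l a)" for l
    proof -
      have "continuous_on (-{0}) (\<lambda>x. g (A l x))"
        by (rule continuous_on_compose2[OF assms]) (auto intro!: continuous_intros)
      then show ?thesis using a f unfolding continuous_on_sequentially o_def by auto
    qed
    then show "AE l in \<nu>. (\<lambda>n. g (A l (f n))) \<longlonglongrightarrow> g (A l a)" by simp
    show "AE l in \<nu>. norm (g (A l (f n))) \<le> B" for n
      using AE_in_msupp B by auto
  qed (use measurable_cont_off_0_A[OF assms] in auto)
  then show "(Q g \<circ> f) \<longlonglongrightarrow> Q g a" by (simp add: Q_def o_def)
qed

lemma Q_add:
  assumes "cont_off_0 f" "cont_off_0 g"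
  shows "Q (\<lambda>x. f x + g x) = (\<lambda>x. Q f x + Q g x)"
  unfolding Q_def using integrable_cont_off_0 assms by (intro ext Bochner_Integration.integral_add) auto

lemma Q_cmult: "Q (\<lambda>x. c * f x) = (\<lambda>x. c * Q f x)"
  unfolding Q_def by simp

lemma Q_const: "Q (\<lambda>x. c) = (\<lambda>x. c)"
  unfolding Q_def by simp

lemma Q_sum:
  assumes "\<And>i. i \<in> I \<Longrightarrow> cont_off_0 (f i)"
  shows "Q (\<lambda>x. \<Sum>i\<in>I. f i x) = (\<lambda>x. \<Sum>i\<in>I. Q (f i) x)"
  unfolding Q_def using integrable_cont_off_0 assms by (intro ext Bochner_Integration.integral_sum) auto

lemma Q_mono:
  assumes "cont_off_0 f" "cont_off_0 g" "\<And>l. l \<in> msupp \<nu> \<Longrightarrow> f (A l x) \<le> g (A l x)"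
  shows "Q f x \<le> Q g x"
  unfolding Q_def using integrable_cont_off_0 assms AE_in_msupp
  by (intro integral_mono_AE) auto

lemma Q_mono':
  assumes "cont_off_0 f" "cont_off_0 g" "\<And>x. x \<noteq> 0 \<Longrightarrow> f x \<le> g x" "x \<noteq> 0"
  shows "Q f x \<le> Q g x"
  using assms by (intro Q_mono) auto

lemma homog0_Q: "homog0 g \<Longrightarrow> homog0 (Q g)"
  unfolding homog0_def Q_def by (simp add: A_mult)

lemma cont_off_0_Q_iter: "cont_off_0 g \<Longrightarrow> cont_off_0 ((Q ^^ k) g)"
  by (induction k) (auto intro: cont_off_0_Q)

lemma homog0_Q_iter: "homog0 g \<Longrightarrow> homog0 ((Q ^^ k) g)"
  by (induction k) (auto intro: homog0_Q)

text \<open>Although \<open>ln (cmod x)\<close> depends on the length of \<open>x\<close>, its mean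
  increment depends only on the direction, since each \<open>A l\<close> is linear.\<close>

definition drift :: "complex \<Rightarrow> real" where
  "drift x = Q (\<lambda>x. ln (cmod x)) x - ln (cmod x)"

lemma cont_off_0_drift: "cont_off_0 drift"
  unfolding drift_def [abs_def]
  by (intro continuous_on_diff cont_off_0_Q cont_off_0_ln_cmod)

lemma drift_eq: "x \<noteq> 0 \<Longrightarrow> drift x = (\<integral>l. ln (cmod (A l x) / cmod x) \<partial>\<nu>)"
  unfolding drift_def Q_def
  using integrable_cont_off_0[OF cont_off_0_ln_cmod, of x]
  by (simp add: ln_div prob_space)

lemma homog0_drift: "homog0 drift"
  unfolding homog0_def
proof (intro allI impI)
  fix t x assume t: "(t::real) \<noteq> 0"
  show "drift (of_real t * x) = drift x"
  proof (cases "x = 0")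
    case False
    then show ?thesis using t by (simp add: drift_eq A_mult norm_mult)
  qed simp
qed

text \<open>Telescoping reduces the mean growth of the norm to a sum of functions on the projective
  line.\<close>

lemma Q_iter_ln:
  "(Q ^^ n) (\<lambda>x. ln (cmod x)) x = ln (cmod x) + (\<Sum>k<n. (Q ^^ k) drift x)"
proof (induction n arbitrary: x)
  case (Suc n)
  have "(Q ^^ Suc n) (\<lambda>x. ln (cmod x)) x = Q (\<lambda>x. ln (cmod x) + (\<Sum>k<n. (Q ^^ k) drift x)) x"
    by (simp add: ext[OF Suc])
  also have "\<dots> = Q (\<lambda>x. ln (cmod x)) x + (\<Sum>k<n. (Q ^^ Suc k) drift x)"
    by (subst Q_add, intro cont_off_0_ln_cmod, intro continuous_intros cont_off_0_Q_iter cont_off_0_drift,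
        subst Q_sum, intro cont_off_0_Q_iter cont_off_0_drift, simp)
  also have "Q (\<lambda>x. ln (cmod x)) x = ln (cmod x) + drift x" by (simp add: drift_def)
  finally show ?case by (simp add: sum.lessThan_Suc_shift del: sum.lessThan_Suc)
qed simp

end

section \<open>The random walk on the plane and its expectations\<close>

context sl2_family begin

fun walk :: "(nat \<Rightarrow> real) \<Rightarrow> complex \<Rightarrow> nat \<Rightarrow> complex" where
  "walk s x 0 = x"
| "walk s x (Suc k) = A (s k) (walk s x k)"

lemma walk_eq_0_iff [simp]: "walk s x k = 0 \<longleftrightarrow> x = 0"
  by (induction k) auto

lemma walk_cong: "(\<And>i. i < k \<Longrightarrow> s i = t i) \<Longrightarrow> walk s x k = walk t x k"
  by (induction k) auto

lemma walk_measurable: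
  assumes "\<And>i. i < k \<Longrightarrow> (\<lambda>\<omega>. s \<omega> i) \<in> borel_measurable N"
  shows "(\<lambda>\<omega>. walk (s \<omega>) x k) \<in> borel_measurable N"
  using assms by (induction k) (auto intro!: measurable_A)

lemma walk_bounds:
  assumes "C \<ge> 1" "\<And>l x. l \<in> msupp \<nu> \<Longrightarrow> cmod (A l x) \<le> C * cmod x"
    "\<And>l x. l \<in> msupp \<nu> \<Longrightarrow> cmod x \<le> C * cmod (A l x)"
    and "\<And>i. i < k \<Longrightarrow> s i \<in> msupp \<nu>"
  shows "cmod (walk s x k) \<le> C ^ k * cmod x \<and> cmod x \<le> C ^ k * cmod (walk s x k)"
  using assms(4)
proof (induction k)
  case (Suc k)
  have IH: "cmod (walk s x k) \<le> C ^ k * cmod x" "cmod x \<le> C ^ k * cmod (walk s x k)"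
    using Suc by auto
  have "cmod (A (s k) (walk s x k)) \<le> C * cmod (walk s x k)" using assms(2) Suc(2) by blast
  also have "\<dots> \<le> C * (C ^ k * cmod x)" using IH assms(1) by (intro mult_left_mono) auto
  finally have 1: "cmod (walk s x (Suc k)) \<le> C ^ Suc k * cmod x" by (simp add: algebra_simps)
  have "cmod x \<le> C ^ k * cmod (walk s x k)" by (rule IH)
  also have "\<dots> \<le> C ^ k * (C * cmod (A (s k) (walk s x k)))"
    using assms(1) assms(3)[OF Suc(2)] by (intro mult_left_mono) auto
  finally show ?case using 1 by (simp add: algebra_simps)
qed simp

end

locale sl2_random_walk = sl2_family \<nu> A + M: prob_space M
  for \<nu> :: "real measure" and A and M :: "'a measure" +
  fixes lam :: "nat \<Rightarrow> 'a \<Rightarrow> real"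
  assumes indep_lam: "M.indep_vars (\<lambda>_. borel) lam UNIV"
    and distr_lam: "distr M borel (lam i) = \<nu>"
begin

lemma lam_measurable [measurable]: "lam i \<in> borel_measurable M"
  using indep_lam unfolding M.indep_vars_def by auto

abbreviation R :: "complex \<Rightarrow> nat \<Rightarrow> 'a \<Rightarrow> complex" where
  "R x k \<omega> \<equiv> walk (\<lambda>i. lam i \<omega>) x k"

lemma R_measurable [measurable]: "R x k \<in> borel_measurable M"
  by (rule walk_measurable) simp

lemma AE_lam_in_msupp: "AE \<omega> in M. \<forall>i. lam i \<omega> \<in> msupp \<nu>"
proof (subst AE_all_countable, intro allI)
  fix i
  have "AE l in distr M borel (lam i). l \<in> msupp \<nu>" 
    unfolding distr_lam by (rule AE_in_msupp)
  moreover have "{l. l \<in> msupp \<nu>} \<in> sets borel" using compact_msupp by (simp add: borel_compact)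
  ultimately show "AE \<omega> in M. lam i \<omega> \<in> msupp \<nu>" 
    using AE_distr_iff[OF lam_measurable[of i], of "\<lambda>l. l \<in> msupp \<nu>"] by simp
qed

lemma AE_R_bounded:
  assumes "cont_off_0 g" "x \<noteq> 0"
  obtains B where "AE \<omega> in M. \<bar>g (R x k \<omega>)\<bar> \<le> B"
proof -
  obtain C where C: "C \<ge> 1" "\<And>l x. l \<in> msupp \<nu> \<Longrightarrow> cmod (A l x) \<le> C * cmod x"
    "\<And>l x. l \<in> msupp \<nu> \<Longrightarrow> cmod x \<le> C * cmod (A l x)"
    using A_bounds by blast
  \<comment> \<open>After \<open>k\<close> steps the walk lies almost surely in this annulus, which
    is compact and avoids 0.\<close>
  define X where "X = cball (0::complex) (C ^ k * cmod x) - ball 0 (cmod x / C ^ k)"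
  have "compact X" unfolding X_def by (intro compact_diff) auto
  moreover have "0 \<notin> X" using assms C(1) by (simp add: X_def)
  ultimately have "compact (g ` X)"
    by (intro compact_continuous_image continuous_on_subset[OF assms(1)]) auto
  then obtain B where B: "\<And>y. y \<in> g ` X \<Longrightarrow> norm y \<le> B"
    using compact_imp_bounded bounded_iff by metis
  have "AE \<omega> in M. \<bar>g (R x k \<omega>)\<bar> \<le> B"
    using AE_lam_in_msupp
  proof eventually_elim
    fix \<omega> assume "\<forall>i. lam i \<omega> \<in> msupp \<nu>"
    then have "R x k \<omega> \<in> X"
      using walk_bounds[OF C, of k "\<lambda>i. lam i \<omega>" x] C(1) by (simp add: X_def field_simps)
    then show "\<bar>g (R x k \<omega>)\<bar> \<le> B" using B[of "g (R x k \<omega>)"] by auto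
  qed
  then show ?thesis by (rule that)
qed

lemma integrable_R:
  assumes "cont_off_0 g" "x \<noteq> 0" shows "integrable M (\<lambda>\<omega>. g (R x k \<omega>))"
proof -
  obtain B where "AE \<omega> in M. \<bar>g (R x k \<omega>)\<bar> \<le> B" using AE_R_bounded assms by blast
  then show ?thesis
    using cont_off_0_measurable[OF assms(1)] by (intro M.integrable_const_bound[where B = B]) auto
qed

text \<open>\<open>indep_var\<close> requires both random variables to have the same type, hence the embedding.\<close>

lemma indep_R_lam: "M.indep_var borel (R x k) borel (\<lambda>\<omega>. complex_of_real (lam k \<omega>))"
proof -
  have "M.indep_var borel ((\<lambda>s. walk s x k) \<circ> (\<lambda>\<omega>. restrict (\<lambda>i. lam i \<omega>) {..<k}))
     borel ((\<lambda>s. complex_of_real (s k)) \<circ> (\<lambda>\<omega>. restrict (\<lambda>i. lam i \<omega>) {k}))"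
  proof (rule M.indep_var_compose[OF M.indep_var_restrict[OF indep_lam]])
    show "(\<lambda>s. walk s x k) \<in> borel_measurable (Pi\<^sub>M {..<k} (\<lambda>_. borel))"
      by (rule walk_measurable) (simp add: measurable_component_singleton)
    have "(\<lambda>s. s k) \<in> borel_measurable (Pi\<^sub>M {k} (\<lambda>_. borel :: real measure))"
      by (rule measurable_component_singleton) simp
    then show "(\<lambda>s. complex_of_real (s k)) \<in> borel_measurable (Pi\<^sub>M {k} (\<lambda>_. borel))"
      
      by measurable
  qed auto
  moreover have "(\<lambda>s. walk s x k) \<circ> (\<lambda>\<omega>. restrict (\<lambda>i. lam i \<omega>) {..<k}) = R x k"
    by (auto simp: fun_eq_iff intro!: walk_cong)
  moreover have "(\<lambda>s. complex_of_real (s k)) \<circ> (\<lambda>\<omega>. restrict (\<lambda>i. lam i \<omega>) {k}) = (\<lambda>\<omega>. complex_of_real (lam k \<omega>))" by auto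
  ultimately show ?thesis by simp
qed

text \<open>Induction with \<open>g\<close> arbitrary peels off the last step: \<open>lam k\<close>
  is independent of \<open>R x k\<close>, so integrating it out first replaces \<open>g\<close> by
  \<open>Q g\<close> at time \<open>k\<close>.\<close>

theorem integral_R:
  assumes "cont_off_0 g" "x \<noteq> 0"
  shows "(\<integral>\<omega>. g (R x k \<omega>) \<partial>M) = (Q ^^ k) g x"
  using assms(1)
proof (induction k arbitrary: g)
  case 0
  then show ?case by (simp add: M.prob_space)
next
  case (Suc k)
  have gm [measurable]: "g \<in> borel_measurable borel" by (rule cont_off_0_measurable[OF Suc(2)])
  let ?D = "distr M borel (R x k)"
  interpret D: prob_space ?D by (intro M.prob_space_distr) simp
  let ?N = "distr M borel (\<lambda>\<omega>. complex_of_real (lam k \<omega>))"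
  \<comment> \<open>\<open>Re\<close> undoes the embedding of \<open>lam k\<close> into the complex
    numbers.\<close>
  let ?G = "\<lambda>y c. g (A (Re c) y)" and ?X = "\<lambda>\<omega>. (R x k \<omega>, complex_of_real (lam k \<omega>))"
  interpret N: prob_space ?N by (intro M.prob_space_distr) simp
  interpret P: pair_prob_space ?D ?N ..
  have eq: "distr M (borel \<Otimes>\<^sub>M borel) ?X = ?D \<Otimes>\<^sub>M ?N"
    using indep_R_lam[of x k] unfolding M.indep_var_distribution_eq by simp
  have X: "?X \<in> measurable M (borel \<Otimes>\<^sub>M borel)" by (intro measurable_Pair) simp_all
  have m: "case_prod ?G \<in> borel_measurable (borel \<Otimes>\<^sub>M borel)"
    unfolding case_prod_beta'
    by (intro measurable_compose[OF _ gm] measurable_A) simp_all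
  have "integrable (distr M (borel \<Otimes>\<^sub>M borel) ?X) (case_prod ?G)"
    unfolding integrable_distr_eq[OF X m]
    using integrable_R[OF Suc(2) assms(2), of "Suc k"] by simp
  then have int: "integrable (?D \<Otimes>\<^sub>M ?N) (case_prod ?G)" by (simp only: eq)
  have Q: "(\<integral>c. ?G y c \<partial>?N) = Q g y" for y
  proof -
    have "(\<integral>c. ?G y c \<partial>?N) = (\<integral>\<omega>. g (A (lam k \<omega>) y) \<partial>M)"
      by (subst integral_distr) (auto intro!: measurable_compose[OF _ gm] measurable_A)
    also have "\<dots> = (\<integral>l. g (A l y) \<partial>distr M borel (lam k))"
      by (subst integral_distr) (auto intro!: measurable_compose[OF _ gm] measurable_A)
    finally show ?thesis by (simp add: Q_def distr_lam)
  qed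
  have "(\<integral>\<omega>. g (R x (Suc k) \<omega>) \<partial>M) = (\<integral>p. case_prod ?G p \<partial>distr M (borel \<Otimes>\<^sub>M borel) ?X)"
    by (subst integral_distr[OF X m]) simp
  also have "\<dots> = (\<integral>p. case_prod ?G p \<partial>(?D \<Otimes>\<^sub>M ?N))" by (simp only: eq)
  also have "\<dots> = (\<integral>y. Q g y \<partial>?D)"
    by (subst P.integral_fst'[OF int, symmetric]) (simp add: Q)
  also have "\<dots> = (\<integral>\<omega>. Q g (R x k \<omega>) \<partial>M)"
    using cont_off_0_measurable[OF cont_off_0_Q[OF Suc(2)]] by (intro integral_distr) auto
  also have "\<dots> = (Q ^^ k) (Q g) x" by (rule Suc(1)[OF cont_off_0_Q[OF Suc(2)]])
  finally show ?case by (simp add: funpow_swap1)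
qed

end

section \<open>Stationary measures\<close>

lemma ex_measurable_angle:
  obtains ang :: "complex \<Rightarrow> real" where "ang \<in> borel_measurable borel"
    "\<And>z. z \<noteq> 0 \<Longrightarrow> cis (ang z) = sgn z" "\<And>z. \<bar>ang z\<bar> \<le> pi"
proof
  define ang :: "complex \<Rightarrow> real" where "ang = (\<lambda>z. if z \<in> -\<real>\<^sub>\<le>\<^sub>0 then Arg z else pi)"
  show "ang \<in> borel_measurable borel"
    unfolding ang_def
    by (intro borel_measurable_continuous_on_if continuous_on_Arg continuous_on_const
        borel_open open_Compl closed_nonpos_Reals_complex)
  show "cis (ang z) = sgn z" if "z \<noteq> 0" for z
  proof (cases "z \<in> -\<real>\<^sub>\<le>\<^sub>0")
    case True
    then show ?thesis using that by (simp add: ang_def cis_Arg)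
  next
    case False
    then have "z \<in> \<real>\<^sub>\<le>\<^sub>0" by simp
    then obtain r where "z = of_real r" "r \<le> 0" by (auto elim: nonpos_Reals_cases)
    with that have "sgn z = -1" by (simp add: sgn_of_real)
    then show ?thesis using False by (simp add: ang_def)
  qed
  show "\<bar>ang z\<bar> \<le> pi" for z
    using Arg_bounded[of z] by (auto simp: ang_def)
qed

lemma cis_comp_bounded_continuous:
  assumes "cont_off_0 g" "homog0 g"
  obtains B where "\<And>\<theta>. isCont (\<lambda>\<theta>. g (cis \<theta>)) \<theta>" "\<And>\<theta>. \<bar>g (cis \<theta>)\<bar> \<le> B"
    "(\<lambda>\<theta>. g (cis \<theta>)) \<in> borel_measurable borel"
proof -
  obtain B where B: "\<And>x. x \<noteq> 0 \<Longrightarrow> \<bar>g x\<bar> \<le> B" using homog0_bounded assms by blast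
  have c: "continuous_on UNIV (\<lambda>\<theta>. g (cis \<theta>))"
    by (rule continuous_on_compose2[OF assms(1)]) (auto intro!: continuous_intros)
  show ?thesis
  proof (rule that)
    show "isCont (\<lambda>\<theta>. g (cis \<theta>)) \<theta>" for \<theta> using c by (simp add: continuous_on_eq_continuous_at)
    show "\<bar>g (cis \<theta>)\<bar> \<le> B" for \<theta> using B by simp
    show "(\<lambda>\<theta>. g (cis \<theta>)) \<in> borel_measurable borel" by (rule borel_measurable_continuous_onI[OF c])
  qed
qed

context sl2_random_walk begin

text \<open>Choose a time uniformly in \<open>{..n}\<close> independently of the walk and record the
  angle of the position at that time: the Cesaro average becomes the law of a single random
  variable.\<close>

lemma ex_cesaro_law:
  assumes "x \<noteq> 0"
  obtains \<mu> where "real_distribution \<mu>" "measure \<mu> {-4<..4} = 1"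
    "\<And>g. cont_off_0 g \<Longrightarrow> homog0 g \<Longrightarrow> (\<integral>\<theta>. g (cis \<theta>) \<partial>\<mu>) = (\<Sum>k\<le>n. (Q ^^ k) g x) / real (Suc n)"
proof -
  obtain ang :: "complex \<Rightarrow> real" where ang: "ang \<in> borel_measurable borel"
    "\<And>z. z \<noteq> 0 \<Longrightarrow> cis (ang z) = sgn z" "\<And>z. \<bar>ang z\<bar> \<le> pi" using ex_measurable_angle by blast
  let ?U = "measure_pmf (pmf_of_set {..n})"
  interpret P: pair_prob_space M ?U ..
  let ?X = "\<lambda>p. ang (R x (snd p) (fst p))"
  have m [measurable]: "?X \<in> borel_measurable (M \<Otimes>\<^sub>M ?U)"
    by (rule measurable_compose_countable[where f = "\<lambda>k p. ang (R x k (fst p))"])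
      (auto intro!: measurable_compose[OF _ ang(1)] measurable_compose[OF measurable_fst])
  define \<mu> where "\<mu> = distr (M \<Otimes>\<^sub>M ?U) borel ?X"
  have "real_distribution \<mu>" unfolding \<mu>_def by (rule P.P.real_distribution_distr[OF m])
  moreover have "measure \<mu> {-4<..4} = 1"
  proof -
    \<comment> \<open>Any half-open interval containing \<open>[-pi, pi]\<close> would do; it gives
      tightness of all these laws at once.\<close>
    have "-4 < ang z \<and> ang z \<le> 4" for z using ang(3)[of z] pi_less_4 by linarith
    then have "?X -` {-4<..4} \<inter> space (M \<Otimes>\<^sub>M ?U) = space (M \<Otimes>\<^sub>M ?U)" by auto
    then show ?thesis unfolding \<mu>_def by (subst measure_distr[OF m]) (simp_all add: P.P.prob_space)
  qed
  moreover have "(\<integral>\<theta>. g (cis \<theta>) \<partial>\<mu>) = (\<Sum>k\<le>n. (Q ^^ k) g x) / real (Suc n)"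
    if g: "cont_off_0 g" "homog0 g" for g
  proof -
    obtain B where B: "\<And>\<theta>. \<bar>g (cis \<theta>)\<bar> \<le> B" and gm: "(\<lambda>\<theta>. g (cis \<theta>)) \<in> borel_measurable borel"
      using cis_comp_bounded_continuous[OF g] by metis
    have int: "integrable (M \<Otimes>\<^sub>M ?U) (case_prod (\<lambda>\<omega> k. g (cis (ang (R x k \<omega>)))))"
      using B measurable_compose[OF m gm]
      by (intro P.P.integrable_const_bound[where B = B]) (auto simp: case_prod_beta')
    have "(\<integral>\<theta>. g (cis \<theta>) \<partial>\<mu>) = (\<integral>p. g (cis (?X p)) \<partial>(M \<Otimes>\<^sub>M ?U))"
      unfolding \<mu>_def by (rule integral_distr[OF m gm])
    also have "\<dots> = (\<integral>k. (\<integral>\<omega>. g (cis (ang (R x k \<omega>))) \<partial>M) \<partial>?U)"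
      using P.integral_snd[OF int] by (simp add: case_prod_beta')
    also have "\<dots> = (\<integral>k. (Q ^^ k) g x \<partial>?U)"
      using assms g by (simp add: ang(2) homog0_sgn integral_R)
    also have "\<dots> = (\<Sum>k\<le>n. (Q ^^ k) g x) / real (Suc n)"
      by (subst integral_pmf_of_set) auto
    finally show ?thesis .
  qed
  ultimately show ?thesis using that by blast
qed

text \<open>The Krylov-Bogoliubov argument. The starting point may vary with \<open>n\<close>,
  because the telescoping error \<open>2 * B / (n + 1)\<close> does not depend on it; the assumption
  on the starting points says by \<open>Q_iter_ln\<close> that the Cesaro average of the drift is
  nonpositive, and this passes to the limit.\<close>

lemma ex_stationary:
  assumes "\<And>n. \<exists>x. x \<noteq> 0 \<and> (Q ^^ Suc n) (\<lambda>x. ln (cmod x)) x \<le> ln (cmod x)"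
  obtains \<mu> where "real_distribution \<mu>"
    "\<And>g. cont_off_0 g \<Longrightarrow> homog0 g \<Longrightarrow> (\<integral>\<theta>. Q g (cis \<theta>) \<partial>\<mu>) = (\<integral>\<theta>. g (cis \<theta>) \<partial>\<mu>)"
    "(\<integral>\<theta>. drift (cis \<theta>) \<partial>\<mu>) \<le> 0"
proof -
  obtain X where X: "\<And>n. X n \<noteq> 0"
    "\<And>n. (Q ^^ Suc n) (\<lambda>x. ln (cmod x)) (X n) \<le> ln (cmod (X n))" using assms by metis
  have "\<exists>\<mu>. real_distribution \<mu> \<and> measure \<mu> {-4<..4} = 1 \<and> (\<forall>g. cont_off_0 g \<longrightarrow> homog0 g \<longrightarrow>
      (\<integral>\<theta>. g (cis \<theta>) \<partial>\<mu>) = (\<Sum>k\<le>n. (Q ^^ k) g (X n)) / real (Suc n))" for n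
    using ex_cesaro_law[OF X(1)[of n], of n] by metis
  then obtain \<mu> where \<mu>: "\<And>n. real_distribution (\<mu> n)" "\<And>n. measure (\<mu> n) {-4<..4} = 1"
    and \<mu>_int: "\<And>n g. cont_off_0 g \<Longrightarrow> homog0 g \<Longrightarrow>
      (\<integral>\<theta>. g (cis \<theta>) \<partial>\<mu> n) = (\<Sum>k\<le>n. (Q ^^ k) g (X n)) / real (Suc n)"
    by metis
  have "tight \<mu>" unfolding tight_def
    using \<mu> by (intro conjI allI impI exI[of _ "-4::real"] exI[of _ "4::real"]) auto
  then obtain r N where r: "strict_mono (r :: nat \<Rightarrow> nat)" and N: "real_distribution N"
    and wc: "weak_conv_m (\<mu> \<circ> id \<circ> r) N"
    using tight_imp_convergent_subsubsequence[of \<mu> id] by (auto simp: strict_mono_def)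
  have conv: "(\<lambda>n. \<integral>\<theta>. g (cis \<theta>) \<partial>\<mu> (r n)) \<longlonglongrightarrow> (\<integral>\<theta>. g (cis \<theta>) \<partial>N)"
    if g: "cont_off_0 g" "homog0 g" for g
  proof -
    obtain B where B: "\<And>\<theta>. \<bar>g (cis \<theta>)\<bar> \<le> B" "\<And>\<theta>. isCont (\<lambda>\<theta>. g (cis \<theta>)) \<theta>"
      using cis_comp_bounded_continuous[OF g] by metis
    show ?thesis
      using weak_conv_imp_integral_bdd_continuous_conv[OF _ N wc, of "\<lambda>\<theta>. g (cis \<theta>)" B] \<mu>(1) B by simp
  qed
  show ?thesis
  proof (rule that[OF N])
    fix g assume g: "cont_off_0 g" "homog0 g"
    have Qg: "cont_off_0 (Q g)" "homog0 (Q g)" using g cont_off_0_Q homog0_Q by auto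
    obtain B where B: "\<And>x. x \<noteq> 0 \<Longrightarrow> \<bar>g x\<bar> \<le> B" using homog0_bounded[OF g] by blast
    have iter: "\<bar>(Q ^^ k) g x\<bar> \<le> B" if "x \<noteq> 0" for k x
      using that
    proof (induction k arbitrary: x)
      case (Suc k)
      have c: "cont_off_0 ((Q ^^ k) g)" using g cont_off_0_Q_iter by blast
      have "Q ((Q ^^ k) g) x \<le> Q (\<lambda>_. B) x" "Q (\<lambda>_. - B) x \<le> Q ((Q ^^ k) g) x"
        using c Suc by (auto intro!: Q_mono' simp: abs_le_iff minus_le_iff)
      then show ?case by (simp add: Q_const)
    qed (use B in auto)
    have "(\<integral>\<theta>. Q g (cis \<theta>) \<partial>\<mu> n) - (\<integral>\<theta>. g (cis \<theta>) \<partial>\<mu> n)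
       = ((Q ^^ Suc n) g (X n) - g (X n)) / real (Suc n)" for n
    proof -
      have "(\<Sum>k\<le>n. (Q ^^ k) (Q g) (X n)) - (\<Sum>k\<le>n. (Q ^^ k) g (X n))
          = (\<Sum>k\<le>n. (Q ^^ Suc k) g (X n) - (Q ^^ k) g (X n))"
        by (simp add: sum_subtractf funpow_swap1)
      also have "\<dots> = (Q ^^ Suc n) g (X n) - g (X n)"
        using sum_lessThan_telescope[of "\<lambda>k. (Q ^^ k) g (X n)" "Suc n"]
        by (simp add: lessThan_Suc_atMost del: sum.atMost_Suc)
      finally show ?thesis
        by (simp only: \<mu>_int[OF g] \<mu>_int[OF Qg] diff_divide_distrib[symmetric])
    qed
    then have "\<bar>(\<integral>\<theta>. Q g (cis \<theta>) \<partial>\<mu> n) - (\<integral>\<theta>. g (cis \<theta>) \<partial>\<mu> n)\<bar> \<le> 2 * B / real (Suc n)" for n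
      using iter[OF X(1)[of n], of "Suc n"] B[OF X(1)[of n]]
      by (simp add: divide_right_mono abs_le_iff)
    then have "(\<lambda>n. (\<integral>\<theta>. Q g (cis \<theta>) \<partial>\<mu> n) - (\<integral>\<theta>. g (cis \<theta>) \<partial>\<mu> n)) \<longlonglongrightarrow> 0"
      by (intro Lim_null_comparison[OF _ lim_const_over_n[THEN LIMSEQ_Suc, of "2 * B"]]) auto
    then have "(\<lambda>n. (\<integral>\<theta>. Q g (cis \<theta>) \<partial>\<mu> (r n)) - (\<integral>\<theta>. g (cis \<theta>) \<partial>\<mu> (r n))) \<longlonglongrightarrow> 0"
      using LIMSEQ_subseq_LIMSEQ[OF _ r] by (fastforce simp: o_def)
    from LIMSEQ_unique[OF this tendsto_diff[OF conv[OF Qg] conv[OF g]]]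
    show "(\<integral>\<theta>. Q g (cis \<theta>) \<partial>N) = (\<integral>\<theta>. g (cis \<theta>) \<partial>N)" by simp
  next
    have "(\<integral>\<theta>. drift (cis \<theta>) \<partial>\<mu> n) \<le> 0" for n
      using X(2)[of n] unfolding Q_iter_ln
      by (subst \<mu>_int[OF cont_off_0_drift homog0_drift])
        (simp add: lessThan_Suc_atMost divide_nonpos_pos del: sum.atMost_Suc)
    then show "(\<integral>\<theta>. drift (cis \<theta>) \<partial>N) \<le> 0"
      by (intro LIMSEQ_le_const2[OF conv[OF cont_off_0_drift homog0_drift]]) auto
  qed
qed

end

section \<open>Atoms of a stationary measure on the projective line\<close>

context sl2_family begin

lemma ex_A_preimage: "\<exists>y. A l y = x"
proof
  have "wedge (A l 1) (A l \<i>) = 1" by (simp add: wedge_A) (simp add: wedge_def)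
  \<comment> \<open>Cramer's rule in the basis formed by the images of 1 and \<open>\<i>\<close>,
    whose determinant is 1.\<close>
  then show "A l (Complex (wedge x (A l \<i>)) (wedge (A l 1) x)) = x"
    by (subst A_eq) (simp add: complex_eq_iff wedge_def, intro conjI, algebra+)
qed

end

locale sl2_stationary = sl2_family \<nu> A + mu: real_distribution \<mu>
  for \<nu> :: "real measure" and A and \<mu> :: "real measure" +
  assumes stationary: "cont_off_0 g \<Longrightarrow> homog0 g \<Longrightarrow> (\<integral>\<theta>. Q g (cis \<theta>) \<partial>\<mu>) = (\<integral>\<theta>. g (cis \<theta>) \<partial>\<mu>)"
    and drift_nonpos: "(\<integral>\<theta>. drift (cis \<theta>) \<partial>\<mu>) \<le> 0"
begin

text \<open>At \<open>x = 0\<close> this is the total mass and not that of a line, so the results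
  about maximal mass ask for nonzero vectors.\<close>

definition line_mass :: "complex \<Rightarrow> real" where
  "line_mass x = measure \<mu> {\<theta>. wedge (cis \<theta>) x = 0}"

lemma line_sets [simp]: "{\<theta>. wedge (cis \<theta>) x = 0} \<in> sets borel"
proof -
  have "closed {\<theta>. wedge (cis \<theta>) x = 0}"
    by (intro closed_Collect_eq continuous_intros)
  then show ?thesis by (simp add: borel_closed)
qed

lemma line_mass_cong:
  assumes "x \<noteq> 0" "y \<noteq> 0" "wedge x y = 0" shows "line_mass x = line_mass y"
  unfolding line_mass_def using wedge_zero_trans[OF assms] by simp

lemma lines_disjoint:
  assumes "wedge x y \<noteq> 0"
  shows "{\<theta>. wedge (cis \<theta>) x = 0} \<inter> {\<theta>. wedge (cis \<theta>) y = 0} = {}"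
proof -
  have "wedge x y = 0" if th: "wedge (cis \<theta>) x = 0" "wedge (cis \<theta>) y = 0" for \<theta>
  proof -
    obtain s where "x = of_real s * cis \<theta>" using wedge_eq_0D[OF th(1) cis_neq_zero] by blast
    moreover obtain t where "y = of_real t * cis \<theta>" using wedge_eq_0D[OF th(2) cis_neq_zero] by blast
    ultimately show ?thesis by simp
  qed
  then show ?thesis using assms by blast
qed

lemma line_mass_add:
  assumes "wedge x y \<noteq> 0"
  shows "line_mass x + line_mass y = measure \<mu> ({\<theta>. wedge (cis \<theta>) x = 0} \<union> {\<theta>. wedge (cis \<theta>) y = 0})"
  unfolding line_mass_def using lines_disjoint[OF assms] by (subst mu.finite_measure_Union) auto

lemma line_mass_add_le_1:
  assumes "wedge x y \<noteq> 0" shows "line_mass x + line_mass y \<le> 1"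
  unfolding line_mass_add[OF assms] by (rule mu.prob_le_1)

lemma line_mass_add3_le_1:
  assumes "wedge x y \<noteq> 0" "wedge x z \<noteq> 0" "wedge y z \<noteq> 0"
  shows "line_mass x + line_mass y + line_mass z \<le> 1"
proof -
  let ?S = "\<lambda>x. {\<theta>. wedge (cis \<theta>) x = 0}"
  have "measure \<mu> ((?S x \<union> ?S y) \<union> ?S z) = measure \<mu> (?S x \<union> ?S y) + measure \<mu> (?S z)"
    using lines_disjoint[OF assms(2)] lines_disjoint[OF assms(3)]
    by (intro mu.finite_measure_Union) (simp_all add: Int_Un_distrib2 sets.Un)
  then have "line_mass x + line_mass y + line_mass z = measure \<mu> (?S x \<union> ?S y \<union> ?S z)"
    using line_mass_add[OF assms(1)] by (simp add: line_mass_def)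
  then show ?thesis using mu.prob_le_1 by simp
qed

text \<open>Stationarity is available only for continuous functions. The indicator of a line is the
  pointwise limit of such functions with values in \<open>[0, 1]\<close>; dominated convergence on
  both sides and Fubini transfer the identity to it.\<close>

lemma line_mass_stationary:
  assumes "x \<noteq> 0"
  shows "integrable \<nu> (\<lambda>l. measure \<mu> {\<theta>. wedge (A l (cis \<theta>)) x = 0})"
    and "(\<integral>l. measure \<mu> {\<theta>. wedge (A l (cis \<theta>)) x = 0} \<partial>\<nu>) = line_mass x"
proof -
  define ind :: "complex \<Rightarrow> real" where "ind = indicator {y. wedge y x = 0}"
  have cl: "closed {y. wedge y x = 0}"
    by (intro closed_Collect_eq continuous_intros)
  then have ind_m: "ind \<in> borel_measurable borel"
    unfolding ind_def by (intro borel_measurable_indicator borel_closed)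
  \<comment> \<open>Up to the factor \<open>cmod x\<close> the quotient is the sine of the angle
    between \<open>y\<close> and \<open>x\<close>, so \<open>g n\<close> is a tent of height 1
    around the line that shrinks to it.\<close>
  define g where "g n y = max 0 (1 - real n * (\<bar>wedge y x\<bar> / cmod y))" for n y
  have gc: "cont_off_0 (g n)" for n
    unfolding g_def [abs_def] by (intro continuous_intros) auto
  have gh: "homog0 (g n)" for n
    unfolding homog0_def g_def by (simp add: norm_mult abs_mult)
  have g_bd: "\<bar>g n y\<bar> \<le> 1" for n y
    by (simp add: g_def)
  have g_lim: "(\<lambda>n. g n y) \<longlonglongrightarrow> ind y" if "y \<noteq> 0" for y
  proof (cases "wedge y x = 0")
    case False
    then have "0 < \<bar>wedge y x\<bar> / cmod y" (is "0 < ?c") using that by simp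
    then obtain n0 where "1 < real n0 * ?c" using reals_Archimedean3 by blast
    then have "1 \<le> real n * ?c" if "n \<ge> n0" for n
      using mult_right_mono[of "real n0" "real n" ?c] that \<open>0 < ?c\<close> by linarith
    then have "eventually (\<lambda>n. g n y = 0) sequentially"
      unfolding eventually_sequentially g_def by (intro exI[of _ n0]) auto
    then show ?thesis using False by (simp add: ind_def tendsto_eventually)
  qed (simp add: g_def ind_def)
  have gm: "g n \<in> borel_measurable borel" for n by (rule cont_off_0_measurable[OF gc])
  have cism: "cis \<in> borel_measurable borel"
    by (intro borel_measurable_continuous_onI continuous_intros)
  have mi: "(\<lambda>p. ind (A (snd p) (cis (fst p)))) \<in> borel_measurable (\<mu> \<Otimes>\<^sub>M \<nu>)"
  proof -
    have "(\<lambda>p. ind (A (snd p) (cis (fst p)))) \<in> borel_measurable (borel \<Otimes>\<^sub>M borel)"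
      by (intro measurable_compose[OF measurable_A ind_m] measurable_compose[OF _ cism]) auto
    then show ?thesis
      by (simp add: measurable_cong_sets[OF sets_pair_measure_cong[OF mu.events_eq_borel sets_nu] refl])
  qed
  interpret P: pair_prob_space \<mu> \<nu> ..
  have int: "integrable (\<mu> \<Otimes>\<^sub>M \<nu>) (case_prod (\<lambda>\<theta> l. ind (A l (cis \<theta>))))"
    using mi by (intro P.P.integrable_const_bound[where B = 1]) (auto simp: case_prod_beta' ind_def indicator_def)
  have lim1: "(\<lambda>n. \<integral>\<theta>. g n (cis \<theta>) \<partial>\<mu>) \<longlonglongrightarrow> (\<integral>\<theta>. ind (cis \<theta>) \<partial>\<mu>)"
  proof (rule integral_dominated_convergence[where w = "\<lambda>_. 1"])
    show "(\<lambda>\<theta>. ind (cis \<theta>)) \<in> borel_measurable \<mu>" "(\<lambda>\<theta>. g n (cis \<theta>)) \<in> borel_measurable \<mu>" for n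
      using measurable_compose[OF cism ind_m] measurable_compose[OF cism gm] by simp_all
  qed (use g_lim g_bd in auto)
  have limQ: "(\<lambda>n. Q (g n) y) \<longlonglongrightarrow> (\<integral>l. ind (A l y) \<partial>\<nu>)" if "y \<noteq> 0" for y
    unfolding Q_def
  proof (rule integral_dominated_convergence[where w = "\<lambda>_. 1"])
    show "(\<lambda>l. ind (A l y)) \<in> borel_measurable \<nu>"
      using measurable_compose[OF measurable_A[of id _ "\<lambda>_. y"] ind_m] by simp
    show "(\<lambda>l. g n (A l y)) \<in> borel_measurable \<nu>" for n
      using measurable_cont_off_0_A[OF gc] by simp
  qed (use g_lim g_bd that in auto)
  have Q_bd: "\<bar>Q (g n) y\<bar> \<le> 1" if "y \<noteq> 0" for n y
    using Q_mono'[OF gc continuous_on_const[of _ 1], of n y] Q_mono'[OF continuous_on_const[of _ "-1"] gc, of n y]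
      g_bd that by (auto simp: Q_const abs_le_iff minus_le_iff)
  have lim2: "(\<lambda>n. \<integral>\<theta>. Q (g n) (cis \<theta>) \<partial>\<mu>) \<longlonglongrightarrow> (\<integral>\<theta>. (\<integral>l. ind (A l (cis \<theta>)) \<partial>\<nu>) \<partial>\<mu>)"
  proof (rule integral_dominated_convergence[where w = "\<lambda>_. 1"])
    show "(\<lambda>\<theta>. \<integral>l. ind (A l (cis \<theta>)) \<partial>\<nu>) \<in> borel_measurable \<mu>"
      using P.integrable_fst[OF int] by (rule borel_measurable_integrable)
    show "(\<lambda>\<theta>. Q (g n) (cis \<theta>)) \<in> borel_measurable \<mu>" for n
      using measurable_compose[OF cism cont_off_0_measurable[OF cont_off_0_Q[OF gc]]] by simp
  qed (use limQ Q_bd in auto)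
  have "(\<integral>\<theta>. ind (cis \<theta>) \<partial>\<mu>) = (\<integral>\<theta>. (\<integral>l. ind (A l (cis \<theta>)) \<partial>\<nu>) \<partial>\<mu>)"
    using LIMSEQ_unique[OF lim1] lim2 stationary[OF gc gh] by simp
  also have "\<dots> = (\<integral>l. (\<integral>\<theta>. ind (A l (cis \<theta>)) \<partial>\<mu>) \<partial>\<nu>)"
    by (rule P.Fubini_integral[OF int, symmetric])
  finally have main: "(\<integral>\<theta>. ind (cis \<theta>) \<partial>\<mu>) = (\<integral>l. (\<integral>\<theta>. ind (A l (cis \<theta>)) \<partial>\<mu>) \<partial>\<nu>)" .
  have meas: "(\<integral>\<theta>. ind (f \<theta>) \<partial>\<mu>) = measure \<mu> {\<theta>. wedge (f \<theta>) x = 0}" if "continuous_on UNIV f" for f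
  proof -
    have "(\<lambda>\<theta>. ind (f \<theta>)) = indicator {\<theta>. wedge (f \<theta>) x = 0}"
      by (auto simp: ind_def indicator_def)
    moreover have "closed {\<theta>. wedge (f \<theta>) x = 0}"
      by (intro closed_Collect_eq continuous_intros that)
    ultimately show ?thesis by (simp add: borel_closed)
  qed
  have m2: "(\<integral>\<theta>. ind (A l (cis \<theta>)) \<partial>\<mu>) = measure \<mu> {\<theta>. wedge (A l (cis \<theta>)) x = 0}" for l
    by (rule meas) (intro continuous_intros)
  show "integrable \<nu> (\<lambda>l. measure \<mu> {\<theta>. wedge (A l (cis \<theta>)) x = 0})"
    using P.integrable_snd[OF int] by (simp add: m2)
  have "(\<integral>\<theta>. ind (cis \<theta>) \<partial>\<mu>) = line_mass x"
    unfolding line_mass_def by (rule meas) (intro continuous_intros)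
  then show "(\<integral>l. measure \<mu> {\<theta>. wedge (A l (cis \<theta>)) x = 0} \<partial>\<nu>) = line_mass x"
    using main by (simp add: m2)
qed

text \<open>A line of mass at least 1/2 is already maximal: a heavier one would be disjoint from it
  and push the total above 1.\<close>

lemma ex_max_line:
  assumes "x \<noteq> 0" "line_mass x \<ge> 1/2"
  obtains y where "y \<noteq> 0" "line_mass y \<ge> 1/2" "\<And>z. z \<noteq> 0 \<Longrightarrow> line_mass z \<le> line_mass y"
proof (cases "\<forall>z. z \<noteq> 0 \<longrightarrow> line_mass z \<le> line_mass x")
  case False
  then obtain y where y: "y \<noteq> 0" "line_mass y > line_mass x" by auto
  have "wedge x y \<noteq> 0" using line_mass_cong[OF assms(1) y(1)] y(2) by auto
  from line_mass_add_le_1[OF this] show ?thesis using y assms(2) by linarith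
qed (use assms that in blast)

text \<open>The maximal mass at \<open>x\<close> is the mean of the masses of the preimages of its
  line, none of which exceeds it. Hence almost every preimage has maximal mass as well, and only two
  lines can have it.\<close>

lemma heavy_line_imp_invariant_lines:
  assumes "x0 \<noteq> 0" "line_mass x0 \<ge> 1/2"
  shows "\<exists>x y. x \<noteq> 0 \<and> y \<noteq> 0 \<and> (\<forall>l\<in>msupp \<nu>. wedge x (A l x) = 0 \<or> wedge x (A l y) = 0)"
proof -
  obtain x where x: "x \<noteq> 0" "line_mass x \<ge> 1/2" and mx: "\<And>z. z \<noteq> 0 \<Longrightarrow> line_mass z \<le> line_mass x"
    using ex_max_line assms by blast
  \<comment> \<open>\<open>y\<close> spans the second line of maximal mass if there is one, and is
    \<open>x\<close> itself otherwise. A third line is impossible, as three masses of at least 1/2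
    exceed 1.\<close>
  obtain y where y: "y \<noteq> 0" and yy: "\<And>z. z \<noteq> 0 \<Longrightarrow> line_mass z = line_mass x \<Longrightarrow> wedge x z = 0 \<or> wedge y z = 0"
  proof (cases "\<exists>y. y \<noteq> 0 \<and> line_mass y = line_mass x \<and> wedge x y \<noteq> 0")
    case True
    then obtain y where y: "y \<noteq> 0" "line_mass y = line_mass x" "wedge x y \<noteq> 0" by blast
    have "wedge x z = 0 \<or> wedge y z = 0" if "z \<noteq> 0" "line_mass z = line_mass x" for z
    proof (rule ccontr)
      assume "\<not> (wedge x z = 0 \<or> wedge y z = 0)"
      then have "line_mass x + line_mass y + line_mass z \<le> 1"
        using y(3) by (intro line_mass_add3_le_1) auto
      then show False using x(2) y(2) that(2) by linarith
    qed
    then show ?thesis using that y by blast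
  qed (use that x in blast)
  have pre: "\<exists>z. z \<noteq> 0 \<and> A l z = x \<and> measure \<mu> {\<theta>. wedge (A l (cis \<theta>)) x = 0} = line_mass z" for l
  proof -
    obtain z where z: "A l z = x" using ex_A_preimage by blast
    then have "wedge (A l (cis \<theta>)) x = wedge (cis \<theta>) z" for \<theta> using wedge_A by metis
    moreover have "z \<noteq> 0" using z x by auto
    ultimately show ?thesis using z by (auto simp: line_mass_def)
  qed
  let ?f = "\<lambda>l. measure \<mu> {\<theta>. wedge (A l (cis \<theta>)) x = 0}"
  have le: "?f l \<le> line_mass x" for l using pre[of l] mx by auto
  note st = line_mass_stationary[OF x(1)]
  have "integrable \<nu> (\<lambda>l. line_mass x - ?f l)" using st(1) by simp
  moreover have "(\<integral>l. line_mass x - ?f l \<partial>\<nu>) = 0" using st by simp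
  ultimately have "AE l in \<nu>. line_mass x - ?f l = 0"
    using le integral_nonneg_eq_0_iff_AE[of \<nu> "\<lambda>l. line_mass x - ?f l"] by simp
  then have "AE l in \<nu>. l \<in> {l. wedge x (A l x) * wedge x (A l y) = 0}"
  proof eventually_elim
    fix l assume l: "line_mass x - ?f l = 0"
    obtain z where z: "z \<noteq> 0" "A l z = x" "?f l = line_mass z" using pre by blast
    then have "wedge x z = 0 \<or> wedge y z = 0" using yy l by simp
    then have "wedge (A l x) (A l z) = 0 \<or> wedge (A l y) (A l z) = 0" by (simp add: wedge_A)
    then show "l \<in> {l. wedge x (A l x) * wedge x (A l y) = 0}"
      using z wedge_commute[of x] by auto
  qed
  \<comment> \<open>The alternative is written as a product to make it a closed condition on
    \<open>l\<close>.\<close>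
  moreover have "closed {l. wedge x (A l x) * wedge x (A l y) = 0}"
    by (intro closed_Collect_eq continuous_intros)
  ultimately have "msupp \<nu> \<subseteq> {l. wedge x (A l x) * wedge x (A l y) = 0}"
    using msupp_subset_closed[OF sets_nu] by blast
  then show ?thesis using x y by auto
qed

end

section \<open>Quadratic forms of determinant 1\<close>

text \<open>The positive definite quadratic forms of determinant 1 on the plane, parametrised by \<open>q\<close>.\<close>

definition qform :: "complex \<Rightarrow> complex \<Rightarrow> real" where
  "qform q x = sqrt (1 + (cmod q)\<^sup>2) * (cmod x)\<^sup>2 + Re (q * x\<^sup>2)"

lemma sqrt_norm_bounds:
  "cmod q < sqrt (1 + (cmod q)\<^sup>2)" "sqrt (1 + (cmod q)\<^sup>2) \<le> 1 + cmod q"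
  by (auto intro!: real_less_rsqrt real_le_lsqrt simp: power2_eq_square algebra_simps)

text \<open>The eigenvalues of the form are \<open>sqrt (1 + |q|^2) + |q|\<close> and
  \<open>sqrt (1 + |q|^2) - |q|\<close>. Their product is 1, so the smaller is the reciprocal of the
  larger, which is at most \<open>1 + 2 * |q|\<close>.\<close>

lemma qform_lower: "(cmod x)\<^sup>2 \<le> (1 + 2 * cmod q) * qform q x"
proof -
  let ?p = "sqrt (1 + (cmod q)\<^sup>2)"
  have "\<bar>Re (q * x\<^sup>2)\<bar> \<le> cmod q * (cmod x)\<^sup>2"
    using abs_Re_le_cmod[of "q * x\<^sup>2"] by (simp add: norm_mult norm_power)
  then have 1: "(?p - cmod q) * (cmod x)\<^sup>2 \<le> qform q x"
    by (simp add: qform_def algebra_simps abs_le_iff)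
  have "(?p + cmod q) * (?p - cmod q) = ?p\<^sup>2 - (cmod q)\<^sup>2" by (simp add: power2_eq_square algebra_simps)
  also have "\<dots> = 1" by (simp add: add_nonneg_nonneg)
  finally have "(cmod x)\<^sup>2 = (?p + cmod q) * ((?p - cmod q) * (cmod x)\<^sup>2)" by (simp add: mult.assoc[symmetric])
  also have "\<dots> \<le> (?p + cmod q) * qform q x"
    using 1 by (intro mult_left_mono) auto
  also have "\<dots> \<le> (1 + 2 * cmod q) * qform q x"
  proof (intro mult_right_mono)
    have "0 \<le> (?p - cmod q) * (cmod x)\<^sup>2" using sqrt_norm_bounds(1)[of q] by (intro mult_nonneg_nonneg) auto
    with 1 show "0 \<le> qform q x" by linarith
  qed (use sqrt_norm_bounds(2)[of q] in linarith)
  finally show ?thesis .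
qed

lemma qform_pos:
  assumes "x \<noteq> 0" shows "0 < qform q x"
proof -
  have "0 < (cmod x)\<^sup>2" using assms by simp
  then have "0 < (1 + 2 * cmod q) * qform q x" using qform_lower[of x q] by linarith
  moreover have "0 < 1 + 2 * cmod q" by (simp add: add_pos_nonneg)
  ultimately show ?thesis by (simp add: zero_less_mult_iff)
qed

lemma qform_upper: "qform q x \<le> (1 + 2 * cmod q) * (cmod x)\<^sup>2"
proof -
  have "Re (q * x\<^sup>2) \<le> cmod q * (cmod x)\<^sup>2"
    using complex_Re_le_cmod[of "q * x\<^sup>2"] by (simp add: norm_mult norm_power)
  moreover have "sqrt (1 + (cmod q)\<^sup>2) * (cmod x)\<^sup>2 \<le> (1 + cmod q) * (cmod x)\<^sup>2"
    by (intro mult_right_mono sqrt_norm_bounds) auto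
  ultimately show ?thesis by (simp add: qform_def algebra_simps)
qed

lemma qform_cis: "qform q (cis \<theta>) = sqrt (1 + (cmod q)\<^sup>2) + Re (q * cis (2 * \<theta>))"
  by (simp add: qform_def Complex.DeMoivre)

lemma qform_scale: "qform q (of_real t * x) = t\<^sup>2 * qform q x"
proof -
  have "q * (of_real t * x)\<^sup>2 = t\<^sup>2 *\<^sub>R (q * x\<^sup>2)"
    by (simp add: power_mult_distrib scaleR_conv_of_real)
  then have "Re (q * (of_real t * x)\<^sup>2) = t\<^sup>2 * Re (q * x\<^sup>2)" by (simp only: scaleR_complex.simps)
  then show ?thesis by (simp add: qform_def norm_mult power_mult_distrib algebra_simps)
qed

lemma ln_qform_cis_bound: "\<bar>ln (qform q (cis \<theta>))\<bar> \<le> ln (1 + 2 * cmod q)"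
proof -
  have pos: "0 < qform q (cis \<theta>)" by (intro qform_pos) simp
  have "1 \<le> (1 + 2 * cmod q) * qform q (cis \<theta>)" using qform_lower[of "cis \<theta>" q] by simp
  then have "0 \<le> ln ((1 + 2 * cmod q) * qform q (cis \<theta>))" by simp
  also have "\<dots> = ln (1 + 2 * cmod q) + ln (qform q (cis \<theta>))"
    using pos by (intro ln_mult_pos) (auto intro: add_pos_nonneg)
  finally have "- ln (1 + 2 * cmod q) \<le> ln (qform q (cis \<theta>))" by simp
  moreover have "ln (qform q (cis \<theta>)) \<le> ln (1 + 2 * cmod q)"
    using qform_upper[of q "cis \<theta>"] pos by simp
  ultimately show ?thesis by (simp add: abs_le_iff)
qed

lemma continuous_on_qform [continuous_intros]:
  "continuous_on S f \<Longrightarrow> continuous_on S g \<Longrightarrow> continuous_on S (\<lambda>t. qform (f t) (g t))"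
  unfolding qform_def by (intro continuous_intros)

lemma cont_off_0_ln_qform: "cont_off_0 (\<lambda>x. ln (qform q x))"
proof (intro continuous_intros ballI)
  fix x :: complex assume "x \<in> - {0}"
  then show "qform q x \<noteq> 0" using qform_pos[of x q] by simp
qed

text \<open>A substitution of determinant 1 keeps the determinant
  \<open>\<alpha> * \<gamma> - \<beta>^2\<close> of the form equal to 1, and every positive form of
  determinant 1 has the shape \<open>qform q'\<close>.\<close>

lemma ex_qform_pullback:
  assumes "wedge u v = 1"
  shows "\<exists>q'. \<forall>x. qform q (of_real (Re x) * u + of_real (Im x) * v) = qform q' x"
proof -
  define a where "a = Re u" define c where "c = Im u"
  define b where "b = Re v" define d where "d = Im v"
  define r where "r = Re q" define s where "s = Im q"
  define p where "p = sqrt (1 + (cmod q)\<^sup>2)"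
  have p2: "p\<^sup>2 = 1 + r\<^sup>2 + s\<^sup>2" by (simp add: p_def r_def s_def cmod_power2 add_nonneg_nonneg)
  have det: "a * d - c * b = 1" using assms by (simp add: wedge_def a_def b_def c_def d_def)
  have Q: "qform q x = (p + r) * (Re x)\<^sup>2 + (p - r) * (Im x)\<^sup>2 - 2 * s * Re x * Im x" for x
    unfolding qform_def p_def[symmetric]
    by (simp add: r_def[symmetric] s_def[symmetric] cmod_power2) (simp add: power2_eq_square algebra_simps)
  define \<alpha> where "\<alpha> = (p + r) * a\<^sup>2 + (p - r) * c\<^sup>2 - 2 * s * a * c"
  define \<gamma> where "\<gamma> = (p + r) * b\<^sup>2 + (p - r) * d\<^sup>2 - 2 * s * b * d"
  define \<beta> where "\<beta> = (p + r) * a * b + (p - r) * c * d - s * (a * d + b * c)"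
  have "\<alpha> * \<gamma> - \<beta>\<^sup>2 = (p\<^sup>2 - r\<^sup>2 - s\<^sup>2) * (a * d - c * b)\<^sup>2"
    unfolding \<alpha>_def \<beta>_def \<gamma>_def by algebra
  then have disc: "\<alpha> * \<gamma> - \<beta>\<^sup>2 = 1" using p2 det by simp
  have "\<alpha> = qform q u" "\<gamma> = qform q v" by (simp_all add: Q \<alpha>_def \<gamma>_def a_def b_def c_def d_def)
  moreover have "u \<noteq> 0" "v \<noteq> 0" using assms by (auto simp: wedge_def)
  ultimately have pos: "\<alpha> > 0" "\<gamma> > 0" using qform_pos by auto
  \<comment> \<open>Read off from the traceless part of the form with coefficients
    \<open>\<alpha>\<close>, \<open>2 * \<beta>\<close>, \<open>\<gamma>\<close>; half the trace is
    then forced by the determinant.\<close>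
  define q' where "q' = Complex ((\<alpha> - \<gamma>) / 2) (- \<beta>)"
  have "1 + (cmod q')\<^sup>2 = ((\<alpha> + \<gamma>) / 2)\<^sup>2"
    unfolding q'_def cmod_power2 using disc by (simp add: power2_eq_square field_simps)
  then have p': "sqrt (1 + (cmod q')\<^sup>2) = (\<alpha> + \<gamma>) / 2" using pos by simp
  have "qform q (of_real (Re x) * u + of_real (Im x) * v) = qform q' x" for x
  proof -
    have "qform q' x = \<alpha> * (Re x)\<^sup>2 + \<gamma> * (Im x)\<^sup>2 + 2 * \<beta> * Re x * Im x"
      unfolding qform_def p' by (simp add: q'_def cmod_power2) (simp add: power2_eq_square field_simps)
    also have "\<dots> = qform q (of_real (Re x) * u + of_real (Im x) * v)"
      unfolding Q \<alpha>_def \<beta>_def \<gamma>_def by (simp add: a_def b_def c_def d_def) algebra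
    finally show ?thesis by simp
  qed
  then show ?thesis by blast
qed

text \<open>Forms of determinant 1 are the points of the hyperbolic plane, and \<open>D\<close> normalises the
  midpoint of two of them. The last claim makes \<open>q \<mapsto> ln (qform q x)\<close> convex, strictly
  so except for the directions \<open>x\<close> where \<open>J\<close> vanishes.\<close>

lemma qform_midpoint:
  fixes q1 q2 :: complex
  defines "p1 \<equiv> sqrt (1 + (cmod q1)\<^sup>2)" and "p2 \<equiv> sqrt (1 + (cmod q2)\<^sup>2)"
  defines "D \<equiv> 2 + 2 * p1 * p2 - 2 * Re (q1 * cnj q2)"
  defines "J \<equiv> \<lambda>z. Im ((of_real p2 * q1 - of_real p1 * q2) * z) + Im (q1 * cnj q2)"
  shows "D > 0"
    and "qform ((q1 + q2) / of_real (sqrt D)) x = (qform q1 x + qform q2 x) / sqrt D"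
    and "(qform q1 (cis \<theta>) + qform q2 (cis \<theta>))\<^sup>2 + (J (cis (2 * \<theta>)))\<^sup>2 = D * (qform q1 (cis \<theta>) * qform q2 (cis \<theta>))"
proof -
  have sq: "p1\<^sup>2 = 1 + (Re q1)\<^sup>2 + (Im q1)\<^sup>2" "p2\<^sup>2 = 1 + (Re q2)\<^sup>2 + (Im q2)\<^sup>2"
    by (simp_all add: p1_def p2_def cmod_power2 add_nonneg_nonneg)
  have "Re (q1 * cnj q2) \<le> cmod q1 * cmod q2"
    using complex_Re_le_cmod[of "q1 * cnj q2"] by (simp add: norm_mult)
  also have "\<dots> \<le> p1 * p2"
    unfolding p1_def p2_def using sqrt_norm_bounds(1)[of q1] sqrt_norm_bounds(1)[of q2] by (intro mult_mono) auto
  finally show D: "D > 0" by (simp add: D_def)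
  have "D + (cmod (q1 + q2))\<^sup>2 = (p1 + p2)\<^sup>2"
    unfolding D_def cmod_power2 using sq by (simp add: power2_eq_square algebra_simps)
  then have "1 + (cmod ((q1 + q2) / of_real (sqrt D)))\<^sup>2 = ((p1 + p2) / sqrt D)\<^sup>2"
    using D by (simp add: norm_divide power_divide field_simps)
  moreover have "(p1 + p2) / sqrt D \<ge> 0" using D by (simp add: p1_def p2_def)
  ultimately have p: "sqrt (1 + (cmod ((q1 + q2) / of_real (sqrt D)))\<^sup>2) = (p1 + p2) / sqrt D"
    by (simp only: real_sqrt_abs abs_of_nonneg)
  have "(q1 + q2) / of_real (sqrt D) * x\<^sup>2 = (q1 * x\<^sup>2 + q2 * x\<^sup>2) / of_real (sqrt D)"
    by (simp add: algebra_simps add_divide_distrib)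
  then have Re_mid: "Re ((q1 + q2) / of_real (sqrt D) * x\<^sup>2) = (Re (q1 * x\<^sup>2) + Re (q2 * x\<^sup>2)) / sqrt D"
    by (simp only: Re_divide_of_real plus_complex.simps)
  have arith: "(a + b) / e * n + (c + d) / e = ((a * n + c) + (b * n + d)) / e" for a b c d e n :: real
    by (simp add: add_divide_distrib algebra_simps)
  show "qform ((q1 + q2) / of_real (sqrt D)) x = (qform q1 x + qform q2 x) / sqrt D"
    unfolding qform_def p Re_mid p1_def[symmetric] p2_def[symmetric] by (rule arith)
  \<comment> \<open>Multiplication by \<open>cis (2 * \<theta>)\<close> rotates the direction to
    angle 0, where the forms take the values \<open>p1 + Re a\<close> and \<open>p2 + Re b\<close>.
    What remains is a polynomial identity modulo the two relations \<open>im\<close>.\<close>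
  define a where "a = q1 * cis (2 * \<theta>)" define b where "b = q2 * cis (2 * \<theta>)"
  have "a * cnj b = q1 * cnj q2 * (cis (2 * \<theta>) * cnj (cis (2 * \<theta>)))" by (simp add: a_def b_def)
  also have "cis (2 * \<theta>) * cnj (cis (2 * \<theta>)) = 1" by (simp add: cis_cnj cis_mult)
  finally have ab: "q1 * cnj q2 = a * cnj b" by simp
  have "cmod a = cmod q1" "cmod b = cmod q2" by (simp_all add: a_def b_def norm_mult)
  then have "p1\<^sup>2 = 1 + (cmod a)\<^sup>2" "p2\<^sup>2 = 1 + (cmod b)\<^sup>2" using sq by (simp_all add: cmod_power2)
  then have im: "(Im a)\<^sup>2 = (p1 - Re a) * (p1 + Re a) - 1" "(Im b)\<^sup>2 = (p2 - Re b) * (p2 + Re b) - 1"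
    unfolding cmod_power2 by (simp_all add: power2_eq_square algebra_simps)
  have J: "J (cis (2 * \<theta>)) = Im a * (p2 + Re b) - Im b * (p1 + Re a)"
  proof -
    have lin: "(of_real p2 * q1 - of_real p1 * q2) * cis (2 * \<theta>) = of_real p2 * a - of_real p1 * b"
      by (simp add: a_def b_def algebra_simps)
    show ?thesis unfolding J_def ab lin by (simp add: algebra_simps)
  qed
  have D': "D = 2 + 2 * p1 * p2 - 2 * (Re a * Re b + Im a * Im b)"
    unfolding D_def ab by simp
  have "((p1 + Re a) + (p2 + Re b))\<^sup>2 + (Im a * (p2 + Re b) - Im b * (p1 + Re a))\<^sup>2
     = (2 + 2 * p1 * p2 - 2 * (Re a * Re b + Im a * Im b)) * ((p1 + Re a) * (p2 + Re b))"
    using im by algebra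
  then show "(qform q1 (cis \<theta>) + qform q2 (cis \<theta>))\<^sup>2 + (J (cis (2 * \<theta>)))\<^sup>2 = D * (qform q1 (cis \<theta>) * qform q2 (cis \<theta>))"
    unfolding qform_cis p1_def[symmetric] p2_def[symmetric] J D' a_def[symmetric] b_def[symmetric] .
qed

text \<open>The condition on \<open>z\<close> defines a real line, which meets the unit circle at
  most twice. With \<open>z = cis (2 * \<theta>)\<close> it confines the zeros of \<open>J\<close>
  to two directions.\<close>

lemma circle_line_two_points:
  assumes "\<kappa> \<noteq> 0" "cmod z0 = 1" "cmod z1 = 1" "cmod z = 1" "z1 \<noteq> z0"
    and "Im (\<kappa> * z0) = d" "Im (\<kappa> * z1) = d" "Im (\<kappa> * z) = d"
  shows "z = z0 \<or> z = z1"
proof -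
  define w where "w = z1 - z0"
  define \<rho> where "\<rho> = Re (\<kappa> * (z - z0)) / Re (\<kappa> * w)"
  have "Im (\<kappa> * w) = 0" "Im (\<kappa> * (z - z0)) = 0" using assms by (simp_all add: w_def algebra_simps)
  then have e: "\<kappa> * w = of_real (Re (\<kappa> * w))" "\<kappa> * (z - z0) = of_real (Re (\<kappa> * (z - z0)))"
    by (simp_all add: complex_eq_iff)
  have "\<kappa> * w \<noteq> 0" using assms by (simp add: w_def)
  then have nz: "Re (\<kappa> * w) \<noteq> 0" using e(1) by (metis of_real_0)
  have "\<kappa> * (z - z0) = \<kappa> * (of_real \<rho> * w)"
  proof -
    have "\<kappa> * (of_real \<rho> * w) = of_real \<rho> * (\<kappa> * w)" by simp
    also have "\<dots> = of_real (\<rho> * Re (\<kappa> * w))" by (subst e(1)) simp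
    also have "\<dots> = \<kappa> * (z - z0)" unfolding \<rho>_def using nz by (subst e(2)) simp
    finally show ?thesis by (rule sym)
  qed
  then have "z - z0 = of_real \<rho> * w" using assms(1) by simp
  then have z: "z = z0 + of_real \<rho> * w" by (simp add: algebra_simps)
  \<comment> \<open>\<open>\<rho>\<close> is the coordinate of \<open>z\<close> along the chord from
    \<open>z0\<close> to \<open>z1\<close>. The squared norm along the chord is quadratic in
    \<open>t\<close> and equals 1 at 0 and at 1, hence nowhere else.\<close>
  have n: "(cmod (z0 + of_real t * w))\<^sup>2 = (cmod z0)\<^sup>2 + 2 * t * (z0 \<bullet> w) + t\<^sup>2 * (cmod w)\<^sup>2" for t
    by (simp add: cmod_power2 inner_complex_def) algebra
  have "1 = 1 + 2 * \<rho> * (z0 \<bullet> w) + \<rho>\<^sup>2 * (cmod w)\<^sup>2" using n[of \<rho>] z assms by simp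
  moreover have "1 = 1 + 2 * (z0 \<bullet> w) + (cmod w)\<^sup>2" using n[of 1] assms by (simp add: w_def)
  ultimately have "\<rho> * (\<rho> - 1) * (cmod w)\<^sup>2 = 0" by algebra
  then have "\<rho> = 0 \<or> \<rho> = 1" using assms by (auto simp: w_def)
  then show ?thesis using z by (auto simp: w_def)
qed

text \<open>Comparing norms in \<open>p2 * q1 = p1 * q2\<close> gives \<open>|q1| = |q2|\<close>,
  hence \<open>p1 = p2\<close> and \<open>q1 = q2\<close>. So for distinct forms the zeros of
  \<open>J\<close> are cut out by a genuine line.\<close>

lemma qform_midpoint_axis_nonzero:
  assumes "q1 \<noteq> q2"
  shows "of_real (sqrt (1 + (cmod q2)\<^sup>2)) * q1 - of_real (sqrt (1 + (cmod q1)\<^sup>2)) * q2 \<noteq> 0"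
proof
  let ?p1 = "sqrt (1 + (cmod q1)\<^sup>2)" and ?p2 = "sqrt (1 + (cmod q2)\<^sup>2)"
  assume "of_real ?p2 * q1 - of_real ?p1 * q2 = 0"
  then have eq: "of_real ?p2 * q1 = of_real ?p1 * q2" by simp
  then have "(cmod (of_real ?p2 * q1))\<^sup>2 = (cmod (of_real ?p1 * q2))\<^sup>2" by simp
  then have "(1 + (cmod q2)\<^sup>2) * (cmod q1)\<^sup>2 = (1 + (cmod q1)\<^sup>2) * (cmod q2)\<^sup>2"
    by (simp add: norm_mult power_mult_distrib add_nonneg_nonneg)
  then have "(cmod q1)\<^sup>2 = (cmod q2)\<^sup>2" by (simp add: algebra_simps)
  then have pp: "?p1 = ?p2" by simp
  have "?p2 \<noteq> 0" using sqrt_norm_bounds(1)[of q2] norm_ge_zero[of q2] by linarith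
  then show False using eq assms unfolding pp by simp
qed

lemma cis_double_eq_imp_wedge:
  assumes "cis (2 * s) = cis (2 * t)" shows "wedge (cis s) (cis t) = 0"
proof -
  have "(cis s)\<^sup>2 = (cis t)\<^sup>2" using assms by (simp add: Complex.DeMoivre)
  then have "cis s = cis t \<or> cis s = - cis t" by (simp only: power2_eq_iff)
  then show ?thesis
  proof
    assume "cis s = - cis t"
    then show ?thesis by (simp add: wedge_def)
  qed simp
qed

section \<open>The barycentre of a stationary measure in the hyperbolic plane\<close>

context sl2_stationary begin

text \<open>The mean of Busemann functions over \<open>\<mu>\<close>; a minimiser is a barycentre of
  \<open>\<mu>\<close>.\<close>

definition \<Psi> :: "complex \<Rightarrow> real" where
  "\<Psi> q = (\<integral>\<theta>. ln (qform q (cis \<theta>)) \<partial>\<mu>)"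

lemma measurable_mu_iff [simp]: "f \<in> measurable \<mu> N \<longleftrightarrow> f \<in> measurable borel N"
  by (simp add: measurable_cong_sets[OF mu.events_eq_borel refl])

lemma measurable_ln_qform_cis: "(\<lambda>\<theta>. ln (qform q (cis \<theta>))) \<in> borel_measurable borel"
  by (rule measurable_compose[OF _ cont_off_0_measurable[OF cont_off_0_ln_qform]])
    (intro borel_measurable_continuous_onI continuous_intros)

lemma integrable_ln_qform_cis: "integrable \<mu> (\<lambda>\<theta>. ln (qform q (cis \<theta>)))"
  using ln_qform_cis_bound measurable_ln_qform_cis
  by (intro mu.integrable_const_bound[where B = "ln (1 + 2 * cmod q)"]) auto

lemma continuous_\<Psi>: "continuous_on UNIV \<Psi>"
proof (unfold continuous_on_sequentially, intro ballI allI impI)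
  fix f :: "nat \<Rightarrow> complex" and a
  assume "(\<forall>n. f n \<in> UNIV) \<and> f \<longlonglongrightarrow> a"
  then have f: "f \<longlonglongrightarrow> a" by simp
  then have "Bseq f" using convergent_imp_Bseq convergentI by blast
  then obtain b where b: "\<And>n. cmod (f n) \<le> b" by (auto simp: Bseq_def)
  have "b \<ge> 0" using b[of 0] norm_ge_zero order_trans by blast
  have "(\<lambda>n. \<integral>\<theta>. ln (qform (f n) (cis \<theta>)) \<partial>\<mu>) \<longlonglongrightarrow> (\<integral>\<theta>. ln (qform a (cis \<theta>)) \<partial>\<mu>)"
  proof (rule integral_dominated_convergence[where w = "\<lambda>_. ln (1 + 2 * b)"])
    have "(\<lambda>n. ln (qform (f n) (cis \<theta>))) \<longlonglongrightarrow> ln (qform a (cis \<theta>))" for \<theta>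
    proof (rule tendsto_ln)
      show "(\<lambda>n. qform (f n) (cis \<theta>)) \<longlonglongrightarrow> qform a (cis \<theta>)"
        unfolding qform_def by (intro tendsto_intros f)
      show "qform a (cis \<theta>) \<noteq> 0" using qform_pos[of "cis \<theta>" a] by simp
    qed
    then show "AE \<theta> in \<mu>. (\<lambda>n. ln (qform (f n) (cis \<theta>))) \<longlonglongrightarrow> ln (qform a (cis \<theta>))" by simp
    have "ln (1 + 2 * cmod (f n)) \<le> ln (1 + 2 * b)" for n
      using b[of n] by (intro ln_mono) (auto intro: add_pos_nonneg)
    then have "\<bar>ln (qform (f n) (cis \<theta>))\<bar> \<le> ln (1 + 2 * b)" for n \<theta>
      using ln_qform_cis_bound order_trans by blast
    then show "AE \<theta> in \<mu>. norm (ln (qform (f n) (cis \<theta>))) \<le> ln (1 + 2 * b)" for n by simp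
  qed (use measurable_ln_qform_cis in auto)
  then show "(\<Psi> \<circ> f) \<longlonglongrightarrow> \<Psi> a" by (simp add: \<Psi>_def o_def)
qed

context
  assumes light: "\<And>x. x \<noteq> 0 \<Longrightarrow> line_mass x < 1/2"
begin

text \<open>If \<open>q\<close> escapes in direction \<open>e\<close>, the form can degenerate only
  where \<open>e * cis (2 * \<theta>) = -1\<close>, which is a single line. Its mass is below 1/2,
  and by continuity from above so is that of a closed neighbourhood.\<close>

lemma ex_light_neighbourhood:
  assumes "cmod e = 1"
  obtains \<eta> where "\<eta> > 0" "measure \<mu> {\<theta>. 1 + Re (e * cis (2 * \<theta>)) \<le> 2 * \<eta>} < 1/2"
proof -
  define S where "S n = {\<theta>. 1 + Re (e * cis (2 * \<theta>)) \<le> 2 * inverse (real (Suc n))}" for n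
  have cl: "closed (S n)" for n
    unfolding S_def by (intro closed_Collect_le continuous_intros)
  \<comment> \<open>\<open>e * cis (2 * \<theta>) = -1\<close> means that the square of
    \<open>cis \<theta>\<close> is \<open>- cnj e\<close>, i.e. that \<open>cis \<theta>\<close> is
    \<open>x0\<close> or \<open>- x0\<close>.\<close>
  define x0 where "x0 = csqrt (- cnj e)"
  have x0: "x0\<^sup>2 = - cnj e" by (simp add: x0_def)
  then have "x0 \<noteq> 0" using assms by auto
  have e1: "e * cnj e = 1" using assms by (simp add: complex_norm_square[symmetric])
  have "(\<Inter>n. S n) \<subseteq> {\<theta>. wedge (cis \<theta>) x0 = 0}"
  proof
    fix \<theta> assume "\<theta> \<in> (\<Inter>n. S n)"
    then have le: "1 + Re (e * cis (2 * \<theta>)) \<le> 2 * inverse (real (Suc n))" for n by (auto simp: S_def)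
    have "(\<lambda>n. 2 * inverse (real (Suc n))) \<longlonglongrightarrow> 2 * 0"
      by (intro tendsto_intros LIMSEQ_inverse_real_of_nat)
    then have "1 + Re (e * cis (2 * \<theta>)) \<le> 0"
      using LIMSEQ_le_const[of "\<lambda>n. 2 * inverse (real (Suc n))" "2 * 0" "1 + Re (e * cis (2 * \<theta>))"] le
      by (simp del: of_nat_Suc)
    moreover have n: "cmod (e * cis (2 * \<theta>)) = 1" using assms by (simp add: norm_mult)
    ultimately have "Re (e * cis (2 * \<theta>)) = -1"
      using abs_Re_le_cmod[of "e * cis (2 * \<theta>)"] by linarith
    moreover have "(Re (e * cis (2 * \<theta>)))\<^sup>2 + (Im (e * cis (2 * \<theta>)))\<^sup>2 = 1"
      using n by (metis cmod_power2 power_one)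
    ultimately have "e * cis (2 * \<theta>) = -1" by (simp add: complex_eq_iff)
    then have "cnj e * (e * cis (2 * \<theta>)) = - cnj e" by simp
    then have "cis (2 * \<theta>) = - cnj e" using e1 by (metis mult.assoc mult.commute mult_1)
    then have "(cis \<theta>)\<^sup>2 = x0\<^sup>2" using x0 by (simp add: Complex.DeMoivre)
    then have "cis \<theta> = x0 \<or> cis \<theta> = - x0" by (simp only: power2_eq_iff)
    then show "\<theta> \<in> {\<theta>. wedge (cis \<theta>) x0 = 0}"
    proof
      assume "cis \<theta> = - x0"
      then have "wedge (cis \<theta>) x0 = wedge (- x0) x0" by (rule arg_cong)
      then show ?thesis by (simp add: wedge_def)
    qed simp
  qed
  then have "measure \<mu> (\<Inter>n. S n) \<le> line_mass x0"
    unfolding line_mass_def by (intro mu.finite_measure_mono) auto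
  then have lt: "measure \<mu> (\<Inter>n. S n) < 1/2" using light[OF \<open>x0 \<noteq> 0\<close>] by linarith
  have "decseq S"
  proof (rule decseq_SucI)
    have "inverse (real (Suc (Suc n))) \<le> inverse (real (Suc n))" for n by (intro le_imp_inverse_le) auto
    then show "S (Suc n) \<subseteq> S n" for n unfolding S_def by (fastforce intro: order_trans)
  qed
  moreover have "range S \<subseteq> sets \<mu>" using cl borel_closed by auto
  ultimately have "(\<lambda>n. measure \<mu> (S n)) \<longlonglongrightarrow> measure \<mu> (\<Inter>n. S n)"
    by (intro mu.finite_Lim_measure_decseq)
  then have "eventually (\<lambda>n. measure \<mu> (S n) < 1/2) sequentially"
    using lt order_tendstoD(2) by blast
  then obtain n where "measure \<mu> (S n) < 1/2" using eventually_sequentially by auto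
  then show ?thesis using that[of "inverse (real (Suc n))"] by (simp add: S_def)
qed

text \<open>Outside a neighbourhood \<open>B\<close> of the degenerate line the integrand is at
  least \<open>ln |q|\<close> minus a constant, on \<open>B\<close> at least \<open>- ln |q|\<close>
  minus a constant. With \<open>m\<close> the mass of \<open>B\<close> this gives
  \<open>\<Psi> q \<ge> (1 - 2 * m) * ln |q| + c\<close>, and \<open>m < 1/2\<close>. A subsequence
  is needed because \<open>B\<close> depends on the limiting direction of \<open>q\<close>.\<close>

lemma \<Psi>_proper: "\<exists>r>0. \<forall>q. cmod q > r \<longrightarrow> \<Psi> q > 0"
proof (rule ccontr)
  assume "\<not> ?thesis"
  then have "\<exists>q. cmod q > real (Suc n) \<and> \<Psi> q \<le> 0" for n
    by (metis not_le of_nat_0_less_iff zero_less_Suc)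
  then obtain q where q: "\<And>n. cmod (q n) > real (Suc n)" "\<And>n. \<Psi> (q n) \<le> 0" by metis
  have q0: "q n \<noteq> 0" for n using q(1)[of n] by auto
  then have "\<forall>n. sgn (q n) \<in> sphere 0 1" by (simp add: norm_sgn)
  then obtain e r where e: "e \<in> sphere 0 1" and r: "strict_mono (r :: nat \<Rightarrow> nat)"
    and lim: "((\<lambda>n. sgn (q n)) \<circ> r) \<longlonglongrightarrow> e"
    using compact_sphere[of "0::complex" 1] unfolding compact_def by meson
  obtain \<eta> where \<eta>: "\<eta> > 0" "measure \<mu> {\<theta>. 1 + Re (e * cis (2 * \<theta>)) \<le> 2 * \<eta>} < 1/2"
    using ex_light_neighbourhood[of e] e by auto
  define B where "B = {\<theta>. 1 + Re (e * cis (2 * \<theta>)) \<le> 2 * \<eta>}"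
  have "closed B" unfolding B_def by (intro closed_Collect_le continuous_intros)
  then have Bs: "B \<in> sets \<mu>" by (simp add: borel_closed)
  define m where "m = measure \<mu> B"
  have m: "m < 1/2" "0 \<le> m" using \<eta>(2) by (simp_all add: m_def B_def)
  define c where "c = ln \<eta> - m * (ln 3 + ln \<eta>)"
  obtain n0 where n0: "\<And>n. n \<ge> n0 \<Longrightarrow> cmod (sgn (q (r n)) - e) < \<eta>"
    using lim \<eta>(1) unfolding LIMSEQ_iff o_def by blast
  have bound: "(1 - 2 * m) * ln (cmod (q (r n))) + c \<le> 0" if n: "n \<ge> n0" for n
  proof -
    define k where "k = q (r n)"
    define T where "T = ln (cmod k)"
    have k1: "cmod k > 1" using q(1)[of "r n"] by (simp add: k_def)
    \<comment> \<open>The indicator merges two bounds: \<open>T + ln \<eta>\<close> off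
      \<open>B\<close> and \<open>- T - ln 3\<close> on \<open>B\<close>.\<close>
    have "T + ln \<eta> + indicator B \<theta> * (- 2 * T - ln 3 - ln \<eta>) \<le> ln (qform k (cis \<theta>))" for \<theta>
    proof (cases "\<theta> \<in> B")
      case True
      have "ln (1 + 2 * cmod k) \<le> ln (3 * cmod k)" using k1 by (intro ln_mono) (auto intro: add_pos_nonneg)
      also have "\<dots> = ln 3 + T" unfolding T_def using k1 by (intro ln_mult_pos) auto
      finally show ?thesis using True ln_qform_cis_bound[of k \<theta>] by simp
    next
      case False
      then have "2 * \<eta> < 1 + Re (e * cis (2 * \<theta>))" by (simp add: B_def)
      moreover have "Re ((e - sgn k) * cis (2 * \<theta>)) \<le> \<eta>"
      proof -
        have "Re ((e - sgn k) * cis (2 * \<theta>)) \<le> cmod ((e - sgn k) * cis (2 * \<theta>))" by (rule complex_Re_le_cmod)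
        also have "\<dots> = cmod (sgn k - e)" by (simp add: norm_mult norm_minus_commute)
        finally show ?thesis using n0[OF n] by (simp add: k_def)
      qed
      ultimately have "\<eta> \<le> 1 + Re (sgn k * cis (2 * \<theta>))" by (simp add: algebra_simps)
      then have "cmod k * \<eta> \<le> cmod k * (1 + Re (sgn k * cis (2 * \<theta>)))"
        by (intro mult_left_mono) auto
      also have "\<dots> = cmod k + Re (k * cis (2 * \<theta>))"
      proof -
        have "k \<noteq> 0" using k1 by auto
        then have "k = cmod k *\<^sub>R sgn k" by (simp add: sgn_div_norm)
        then have "k * cis (2 * \<theta>) = cmod k *\<^sub>R (sgn k * cis (2 * \<theta>))" by (metis mult_scaleR_left)
        then have "Re (k * cis (2 * \<theta>)) = cmod k * Re (sgn k * cis (2 * \<theta>))"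
          by (simp only: scaleR_complex.simps)
        then show ?thesis by (simp only: distrib_left mult_1_right)
      qed
      also have "\<dots> \<le> qform k (cis \<theta>)" unfolding qform_cis using sqrt_norm_bounds(1)[of k] by simp
      finally have "ln (cmod k * \<eta>) \<le> ln (qform k (cis \<theta>))"
        using k1 \<eta>(1) by (intro ln_mono mult_pos_pos) (auto intro: order.strict_trans[OF zero_less_one])
      moreover have "ln (cmod k * \<eta>) = T + ln \<eta>" unfolding T_def using k1 \<eta>(1) by (intro ln_mult_pos) auto
      ultimately show ?thesis using False by simp
    qed
    then have "(\<integral>\<theta>. T + ln \<eta> + indicator B \<theta> * (- 2 * T - ln 3 - ln \<eta>) \<partial>\<mu>) \<le> \<Psi> k"
      unfolding \<Psi>_def using Bs integrable_ln_qform_cis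
      by (intro integral_mono) (auto simp: mu.emeasure_eq_measure)
    moreover have "(\<integral>\<theta>. T + ln \<eta> + indicator B \<theta> * (- 2 * T - ln 3 - ln \<eta>) \<partial>\<mu>)
        = T + ln \<eta> + m * (- 2 * T - ln 3 - ln \<eta>)"
      using Bs mu.prob_space by (subst Bochner_Integration.integral_add) (auto simp: m_def mu.emeasure_eq_measure)
    ultimately have "T + ln \<eta> + m * (- 2 * T - ln 3 - ln \<eta>) \<le> 0" using q(2)[of "r n"] by (simp add: k_def)
    then show ?thesis by (simp add: T_def k_def c_def algebra_simps)
  qed
  have "filterlim (\<lambda>n. (1 - 2 * m) * ln (real (Suc n)) + c) at_top sequentially"
  proof -
    have "filterlim (\<lambda>n. ln (real (Suc n))) at_top sequentially"
      by (rule filterlim_compose[OF ln_at_top]) (rule filterlim_compose[OF filterlim_real_sequentially filterlim_Suc])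
    then have "filterlim (\<lambda>n. (1 - 2 * m) * ln (real (Suc n))) at_top sequentially"
      using m by (intro filterlim_tendsto_pos_mult_at_top[OF tendsto_const]) auto
    then show ?thesis
      using filterlim_tendsto_add_at_top[OF tendsto_const, of _ _ c] by (simp add: add.commute)
  qed
  then obtain n1 where n1: "\<And>n. n \<ge> n1 \<Longrightarrow> (1 - 2 * m) * ln (real (Suc n)) + c \<ge> 1"
    unfolding filterlim_at_top eventually_sequentially by blast
  define n where "n = max n0 n1"
  have "n \<le> r n" using r seq_suble by blast
  then have "real (Suc n) \<le> cmod (q (r n))" using q(1)[of "r n"] by linarith
  then have "(1 - 2 * m) * ln (real (Suc n)) \<le> (1 - 2 * m) * ln (cmod (q (r n)))"
    using m by (intro mult_left_mono ln_mono) auto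
  then show False using bound[of n] n1[of n] by (simp add: n_def)
qed

lemma ex_min_\<Psi>: "\<exists>q. \<forall>q'. \<Psi> q \<le> \<Psi> q'"
proof -
  obtain r where r: "r > 0" "\<And>q. cmod q > r \<Longrightarrow> \<Psi> q > 0" using \<Psi>_proper by blast
  have "continuous_on (cball 0 r) \<Psi>" using continuous_\<Psi> continuous_on_subset by blast
  then obtain q where q: "q \<in> cball 0 r" "\<And>q'. q' \<in> cball 0 r \<Longrightarrow> \<Psi> q \<le> \<Psi> q'"
    using continuous_attains_inf[OF compact_cball, of 0 r \<Psi>] r(1) by (metis cball_eq_empty not_less order_less_imp_le)
  \<comment> \<open>\<open>q = 0\<close> is the round form, which is 1 on the circle. So the minimum
    over the ball is at most 0, while all values outside are positive.\<close>
  have "\<Psi> 0 = 0" by (simp add: \<Psi>_def qform_def)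
  then have "\<Psi> q \<le> 0" using q(2)[of 0] r(1) by simp
  have "\<Psi> q \<le> \<Psi> q'" for q'
    using q(2)[of q'] r(2)[of q'] \<open>\<Psi> q \<le> 0\<close> by (cases "cmod q' > r") auto
  then show ?thesis by blast
qed

text \<open>\<open>f\<close> is the convexity defect at the midpoint \<open>q\<close>. It is
  nonnegative, and minimality at both ends makes its integral at most 0, so \<open>J\<close>
  vanishes almost everywhere. The zeros of \<open>J\<close> lie on one or two lines, which would
  carry total mass 1, although each has less than 1/2.\<close>

lemma min_\<Psi>_unique:
  assumes "\<And>q. \<Psi> q1 \<le> \<Psi> q" "\<Psi> q2 = \<Psi> q1"
  shows "q1 = q2"
proof (rule ccontr)
  assume neq: "q1 \<noteq> q2"
  define p1 where "p1 = sqrt (1 + (cmod q1)\<^sup>2)" define p2 where "p2 = sqrt (1 + (cmod q2)\<^sup>2)"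
  define D where "D = 2 + 2 * p1 * p2 - 2 * Re (q1 * cnj q2)"
  define \<kappa> where "\<kappa> = of_real p2 * q1 - of_real p1 * q2"
  define J where "J z = Im (\<kappa> * z) + Im (q1 * cnj q2)" for z
  define q where "q = (q1 + q2) / of_real (sqrt D)"
  note mid = qform_midpoint[where ?q1.0 = q1 and ?q2.0 = q2, folded p1_def p2_def, folded D_def \<kappa>_def, folded J_def q_def]
  have \<kappa>: "\<kappa> \<noteq> 0" using qform_midpoint_axis_nonzero[OF neq] by (simp add: \<kappa>_def p1_def p2_def)
  define f where "f \<theta> = ln (qform q1 (cis \<theta>)) / 2 + ln (qform q2 (cis \<theta>)) / 2 - ln (qform q (cis \<theta>))" for \<theta>
  have f: "0 \<le> f \<theta> \<and> (f \<theta> = 0 \<longrightarrow> J (cis (2 * \<theta>)) = 0)" for \<theta>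
  proof -
    define s1 where "s1 = qform q1 (cis \<theta>)" define s2 where "s2 = qform q2 (cis \<theta>)"
    have pos: "s1 > 0" "s2 > 0" "D > 0" using qform_pos mid(1) by (simp_all add: s1_def s2_def)
    have e: "(s1 + s2)\<^sup>2 + (J (cis (2 * \<theta>)))\<^sup>2 = D * (s1 * s2)" using mid(3) by (simp add: s1_def s2_def)
    have "ln (D * (s1 * s2)) = ln D + (ln s1 + ln s2)" using pos by (simp add: ln_mult_pos)
    moreover have "ln ((s1 + s2)\<^sup>2) = 2 * ln (s1 + s2)" using pos by (simp add: ln_realpow)
    moreover have "ln (qform q (cis \<theta>)) = ln (s1 + s2) - ln D / 2"
      using pos mid(2) by (simp add: s1_def[symmetric] s2_def[symmetric] ln_div ln_sqrt)
    ultimately have f2: "2 * f \<theta> = ln (D * (s1 * s2)) - ln ((s1 + s2)\<^sup>2)"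
      by (simp add: f_def s1_def[symmetric] s2_def[symmetric])
    have sq: "0 < (s1 + s2)\<^sup>2" using pos by simp
    have "(s1 + s2)\<^sup>2 \<le> D * (s1 * s2)" using e zero_le_power2[of "J (cis (2 * \<theta>))"] by linarith
    then have "ln ((s1 + s2)\<^sup>2) \<le> ln (D * (s1 * s2))" using sq by (intro ln_mono) auto
    moreover have "J (cis (2 * \<theta>)) = 0" if "f \<theta> = 0"
    proof -
      have "ln (D * (s1 * s2)) = ln ((s1 + s2)\<^sup>2)" using that f2 by simp
      then have "D * (s1 * s2) = (s1 + s2)\<^sup>2" using pos sq by (subst (asm) ln_inj_iff) auto
      then show ?thesis using e by simp
    qed
    ultimately show ?thesis using f2 by simp
  qed
  have int: "integrable \<mu> f" unfolding f_def by (intro Bochner_Integration.integrable_diff Bochner_Integration.integrable_add integrable_divide_zero integrable_ln_qform_cis) 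
  have "(\<integral>\<theta>. f \<theta> \<partial>\<mu>) = \<Psi> q1 / 2 + \<Psi> q2 / 2 - \<Psi> q"
    unfolding f_def \<Psi>_def by (simp add: integrable_ln_qform_cis)
  also have "\<dots> \<le> 0" using assms(1)[of q] assms(2) by simp
  finally have "(\<integral>\<theta>. f \<theta> \<partial>\<mu>) = 0" using f by (intro antisym integral_nonneg) auto
  then have "AE \<theta> in \<mu>. f \<theta> = 0" using integral_nonneg_eq_0_iff_AE[OF int] f by simp
  then have AEJ: "AE \<theta> in \<mu>. J (cis (2 * \<theta>)) = 0" using f by (auto elim: eventually_mono)
  have one: "line_mass x \<ge> 1" if "AE \<theta> in \<mu>. wedge (cis \<theta>) x = 0" for x
    using mu.prob_Collect_eq_1[of "\<lambda>\<theta>. wedge (cis \<theta>) x = 0"] that by (simp add: line_mass_def)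
  have "\<exists>s. J (cis (2 * s)) = 0"
    using mu.AE_E_prob[OF AEJ] mu.prob_space by (metis (mono_tags, lifting) AEJ eventually_False eventually_mono mu.AE_False)
  then obtain s where s: "J (cis (2 * s)) = 0" by blast
  show False
  proof (cases "\<forall>t. J (cis (2 * t)) = 0 \<longrightarrow> wedge (cis t) (cis s) = 0")
    case True
    then have "AE \<theta> in \<mu>. wedge (cis \<theta>) (cis s) = 0" using AEJ by (auto elim: eventually_mono)
    then show False using one light[of "cis s"] by fastforce
  next
    case False
    then obtain t where t: "J (cis (2 * t)) = 0" "wedge (cis t) (cis s) \<noteq> 0" by blast
    have ne: "cis (2 * t) \<noteq> cis (2 * s)" using t cis_double_eq_imp_wedge by blast
    have "wedge (cis \<theta>) (cis s) = 0 \<or> wedge (cis \<theta>) (cis t) = 0" if "J (cis (2 * \<theta>)) = 0" for \<theta>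
    proof -
      have "cis (2 * \<theta>) = cis (2 * s) \<or> cis (2 * \<theta>) = cis (2 * t)"
        by (rule circle_line_two_points[OF \<kappa> _ _ _ ne, of _ "- Im (q1 * cnj q2)"])
          (use that s t in \<open>simp_all add: J_def\<close>)
      then show ?thesis using cis_double_eq_imp_wedge by blast
    qed
    then have "AE \<theta> in \<mu>. \<theta> \<in> {\<theta>. wedge (cis \<theta>) (cis s) = 0} \<union> {\<theta>. wedge (cis \<theta>) (cis t) = 0}"
      using AEJ by (auto elim: eventually_mono)
    then have "measure \<mu> ({\<theta>. wedge (cis \<theta>) (cis s) = 0} \<union> {\<theta>. wedge (cis \<theta>) (cis t) = 0}) = 1"
      by (intro mu.prob_eq_1[THEN iffD2]) auto
    then have "line_mass (cis s) + line_mass (cis t) = 1"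
      using t(2) by (subst line_mass_add) (auto simp: wedge_commute[of "cis s"])
    then show False using light[of "cis s"] light[of "cis t"] by simp
  qed
qed

text \<open>The minimiser works: the mean of \<open>\<Psi>\<close> over its pullbacks does not
  exceed the minimum, so almost every pullback is again a minimiser and equals \<open>q\<close> by
  uniqueness.\<close>

lemma ex_invariant_form: "\<exists>q. \<forall>l\<in>msupp \<nu>. \<forall>x. qform q (A l x) = qform q x"
proof -
  obtain q where min: "\<And>q'. \<Psi> q \<le> \<Psi> q'" using ex_min_\<Psi> by blast
  have "\<exists>q'. \<forall>x. qform q (A l x) = qform q' x" for l
  proof -
    have "wedge (A l 1) (A l \<i>) = 1" by (simp add: wedge_A) (simp add: wedge_def)
    from ex_qform_pullback[OF this, of q] show ?thesis by (simp flip: A_eq)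
  qed
  then obtain pb where pb: "\<And>l x. qform q (A l x) = qform (pb l) x" by metis
  \<comment> \<open>Subtracting twice the logarithm of the norm removes the degree 2 of the form, so
    \<open>g\<close> lives on the projective line and stationarity applies to it.\<close>
  define g where "g x = ln (qform q x) - 2 * ln (cmod x)" for x
  have gc: "cont_off_0 g" unfolding g_def [abs_def]
    by (intro continuous_on_diff cont_off_0_ln_qform continuous_on_mult continuous_on_const cont_off_0_ln_cmod)
  have gh: "homog0 g" unfolding homog0_def
  proof (intro allI impI)
    fix t :: real and x :: complex assume t: "t \<noteq> 0"
    show "g (of_real t * x) = g x"
    proof (cases "x = 0")
      case False
      have "ln (t\<^sup>2 * qform q x) = ln (t\<^sup>2) + ln (qform q x)"
        using t qform_pos[OF False, of q] by (intro ln_mult_pos) auto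
      moreover have "ln (t\<^sup>2) = 2 * ln \<bar>t\<bar>" using ln_realpow[of "\<bar>t\<bar>" 2] t by simp
      moreover have "ln (\<bar>t\<bar> * cmod x) = ln \<bar>t\<bar> + ln (cmod x)" using t False by (intro ln_mult_pos) auto
      ultimately show ?thesis by (simp add: g_def qform_scale norm_mult)
    qed simp
  qed
  have cism: "cis \<in> borel_measurable borel"
    by (intro borel_measurable_continuous_onI continuous_intros)
  have int_hom: "integrable \<mu> (\<lambda>\<theta>. h (cis \<theta>))" if h: "cont_off_0 h" "homog0 h" for h
  proof -
    obtain B where "\<And>\<theta>. \<bar>h (cis \<theta>)\<bar> \<le> B" using cis_comp_bounded_continuous[OF h] by metis
    then show ?thesis
      using measurable_compose[OF cism cont_off_0_measurable[OF h(1)]]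
      by (intro mu.integrable_const_bound[where B = B]) auto
  qed
  have split: "Q (\<lambda>x. ln (qform q x)) (cis \<theta>) = Q g (cis \<theta>) + 2 * drift (cis \<theta>)" for \<theta>
  proof -
    have "Q (\<lambda>x. ln (qform q x)) = Q (\<lambda>x. g x + 2 * ln (cmod x))" by (simp add: g_def)
    also have "\<dots> = (\<lambda>x. Q g x + Q (\<lambda>x. 2 * ln (cmod x)) x)"
      by (intro Q_add gc continuous_on_mult continuous_on_const cont_off_0_ln_cmod)
    finally show ?thesis by (simp add: Q_cmult drift_def)
  qed
  have "(\<integral>\<theta>. Q (\<lambda>x. ln (qform q x)) (cis \<theta>) \<partial>\<mu>) = (\<integral>\<theta>. Q g (cis \<theta>) \<partial>\<mu>) + 2 * (\<integral>\<theta>. drift (cis \<theta>) \<partial>\<mu>)"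
    unfolding split
    using int_hom[OF cont_off_0_Q[OF gc] homog0_Q[OF gh]] int_hom[OF cont_off_0_drift homog0_drift] by simp
  also have "\<dots> \<le> (\<integral>\<theta>. g (cis \<theta>) \<partial>\<mu>)" using stationary[OF gc gh] drift_nonpos by simp
  also have "\<dots> = \<Psi> q" by (simp add: g_def \<Psi>_def)
  finally have le: "(\<integral>\<theta>. Q (\<lambda>x. ln (qform q x)) (cis \<theta>) \<partial>\<mu>) \<le> \<Psi> q" .
  interpret P: pair_prob_space \<mu> \<nu> ..
  have "compact (range cis)"
  proof -
    have "range cis = sphere 0 1"
    proof
      show "sphere 0 1 \<subseteq> range cis"
      proof
        fix z :: complex assume "z \<in> sphere 0 1"
        then have "cmod z = 1" "z \<noteq> 0" by auto
        then have "z = cis (Arg z)" by (simp add: cis_Arg sgn_div_norm)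
        then show "z \<in> range cis" by blast
      qed
    qed auto
    then show ?thesis by simp
  qed
  then obtain B where B: "\<And>l \<theta>. l \<in> msupp \<nu> \<Longrightarrow> \<bar>ln (qform q (A l (cis \<theta>)))\<bar> \<le> B"
    using bounded_on_compact[OF cont_off_0_ln_qform, of "range cis"] by (metis cis_neq_zero imageE rangeI)
  have sets_P: "sets (\<mu> \<Otimes>\<^sub>M \<nu>) = sets (borel \<Otimes>\<^sub>M borel)"
    by (rule sets_pair_measure_cong[OF mu.events_eq_borel sets_nu])
  have int: "integrable (\<mu> \<Otimes>\<^sub>M \<nu>) (case_prod (\<lambda>\<theta> l. ln (qform q (A l (cis \<theta>)))))"
  proof (rule P.P.integrable_const_bound[where B = B])
    have "(\<lambda>p. ln (qform q (A (snd p) (cis (fst p))))) \<in> borel_measurable (borel \<Otimes>\<^sub>M borel)"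
      by (intro measurable_compose[OF measurable_A cont_off_0_measurable[OF cont_off_0_ln_qform]]
          measurable_compose[OF _ cism]) auto
    then show "case_prod (\<lambda>\<theta> l. ln (qform q (A l (cis \<theta>)))) \<in> borel_measurable (\<mu> \<Otimes>\<^sub>M \<nu>)"
      by (simp add: measurable_cong_sets[OF sets_P refl] case_prod_beta')
    have "{p \<in> space (\<mu> \<Otimes>\<^sub>M \<nu>). snd p \<in> msupp \<nu>} = UNIV \<times> msupp \<nu>"
      by (auto simp: space_pair_measure)
    also have "\<dots> \<in> sets (\<mu> \<Otimes>\<^sub>M \<nu>)"
      unfolding sets_P using compact_msupp by (intro pair_measureI) (auto simp: borel_compact)
    finally have "AE p in \<mu> \<Otimes>\<^sub>M \<nu>. snd p \<in> msupp \<nu>"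
      using AE_in_msupp by (intro P.AE_pair_measure) auto
    then show "AE p in \<mu> \<Otimes>\<^sub>M \<nu>. norm (case p of (\<theta>, l) \<Rightarrow> ln (qform q (A l (cis \<theta>)))) \<le> B"
      by eventually_elim (use B in \<open>auto split: prod.splits\<close>)
  qed
  have fub: "(\<integral>\<theta>. Q (\<lambda>x. ln (qform q x)) (cis \<theta>) \<partial>\<mu>) = (\<integral>l. \<Psi> (pb l) \<partial>\<nu>)"
    unfolding Q_def \<Psi>_def pb[symmetric] by (rule P.Fubini_integral[OF int, symmetric])
  have int2: "integrable \<nu> (\<lambda>l. \<Psi> (pb l))"
    unfolding \<Psi>_def pb[symmetric] by (rule P.integrable_snd[OF int])
  then have int3: "integrable \<nu> (\<lambda>l. \<Psi> (pb l) - \<Psi> q)" by simp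
  \<comment> \<open>The integrand is nonnegative by minimality, and its mean is nonpositive by
    \<open>le\<close> after exchanging the integrals.\<close>
  have "(\<integral>l. \<Psi> (pb l) - \<Psi> q \<partial>\<nu>) = 0"
  proof (rule antisym)
    show "(\<integral>l. \<Psi> (pb l) - \<Psi> q \<partial>\<nu>) \<le> 0" using int2 le fub by simp
  qed (use min in \<open>simp add: integral_nonneg\<close>)
  then have "AE l in \<nu>. \<Psi> (pb l) - \<Psi> q = 0"
    using integral_nonneg_eq_0_iff_AE[OF int3] min by simp
  then have AEq: "AE l in \<nu>. pb l = q"
    by eventually_elim (use min_\<Psi>_unique[OF min] in auto)
  have "qform q (A l x) = qform q x" if "l \<in> msupp \<nu>" for l x
  proof -
    have "AE l in \<nu>. l \<in> {l. qform q (A l x) = qform q x}"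
      using AEq by eventually_elim (simp add: pb)
    moreover have "closed {l. qform q (A l x) = qform q x}"
      by (intro closed_Collect_eq continuous_intros)
    ultimately show ?thesis using msupp_subset_closed[OF sets_nu] that by blast
  qed
  then show ?thesis by blast
qed

end

end

section \<open>Contraction and the Lyapunov exponent\<close>

lemma exp_le_quadratic:
  fixes y :: real assumes "\<bar>y\<bar> \<le> 1" shows "exp y \<le> 1 + y + y\<^sup>2"
proof (cases "y \<ge> 0")
  case True
  then show ?thesis using exp_bound assms by simp
next
  case False
  have "exp y = 1 / exp (- y)" by (simp add: exp_minus field_simps)
  also have "\<dots> \<le> 1 / (1 - y)"
    using False exp_ge_add_one_self[of "- y"] by (intro divide_left_mono) auto
  also have "\<dots> \<le> 1 + y + y\<^sup>2"
  proof -
    have "y * y\<^sup>2 \<le> 0" using False by (simp add: mult_nonpos_nonneg)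
    moreover have "(1 + y + y\<^sup>2) * (1 - y) = 1 - y * y\<^sup>2" by (simp add: power2_eq_square algebra_simps)
    ultimately have "1 \<le> (1 + y + y\<^sup>2) * (1 - y)" by linarith
    then show ?thesis using False by (simp add: pos_divide_le_eq)
  qed
  finally show ?thesis .
qed

text \<open>A distance between directions that ignores the signs of the unit vectors; the product
  form suits a difference of squared norms.\<close>

lemma cmod_diff_times_sum:
  assumes "cmod x = 1" "cmod y = 1"
  shows "cmod (x - y) * cmod (x + y) = 2 * \<bar>wedge x y\<bar>"
proof (rule power2_eq_imp_eq)
  have "(cmod (x - y) * cmod (x + y))\<^sup>2 = ((cmod x)\<^sup>2 + (cmod y)\<^sup>2)\<^sup>2 - (2 * (x \<bullet> y))\<^sup>2"
    by (simp only: power_mult_distrib cmod_power2) (simp add: inner_complex_def, algebra)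
  also have "\<dots> = 4 * ((cmod x)\<^sup>2 * (cmod y)\<^sup>2 - (x \<bullet> y)\<^sup>2)"
    using assms by (simp add: power_mult_distrib)
  also have "\<dots> = (2 * \<bar>wedge x y\<bar>)\<^sup>2" by (simp add: wedge_squared[symmetric] power_mult_distrib)
  finally show "(cmod (x - y) * cmod (x + y))\<^sup>2 = (2 * \<bar>wedge x y\<bar>)\<^sup>2" .
qed auto

context sl2_family begin

lemma ex_increment_bound:
  assumes "cont_off_0 h" "homog0 h"
  obtains C where "C > 0"
    "\<And>l x. l \<in> msupp \<nu> \<Longrightarrow> x \<noteq> 0 \<Longrightarrow> \<bar>(ln (cmod (A l x)) + h (A l x)) - (ln (cmod x) + h x)\<bar> \<le> C"
proof -
  obtain C where C: "C \<ge> 1" "\<And>l x. l \<in> msupp \<nu> \<Longrightarrow> cmod (A l x) \<le> C * cmod x"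
    "\<And>l x. l \<in> msupp \<nu> \<Longrightarrow> cmod x \<le> C * cmod (A l x)" using A_bounds by blast
  obtain B where B: "\<And>x. x \<noteq> 0 \<Longrightarrow> \<bar>h x\<bar> \<le> B" using homog0_bounded assms by blast
  have "B \<ge> 0" using B[of 1] by auto
  \<comment> \<open>The summand 1 only makes the constant strictly positive, so that it can serve as
    a divisor.\<close>
  have "\<bar>(ln (cmod (A l x)) + h (A l x)) - (ln (cmod x) + h x)\<bar> \<le> ln C + 2 * B + 1"
    if l: "l \<in> msupp \<nu>" and x: "x \<noteq> 0" for l x
  proof -
    have "ln (cmod (A l x)) \<le> ln (C * cmod x)" "ln (cmod x) \<le> ln (C * cmod (A l x))"
      using C(2,3)[OF l, of x] x by (auto intro!: ln_mono)
    moreover have "ln (C * cmod x) = ln C + ln (cmod x)" "ln (C * cmod (A l x)) = ln C + ln (cmod (A l x))"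
      using C(1) x by (auto intro!: ln_mult_pos)
    ultimately show ?thesis using B[of x] B[of "A l x"] x by simp
  qed
  moreover have "0 < ln C + 2 * B + 1" using C(1) \<open>B \<ge> 0\<close> ln_ge_zero[of C] by linarith
  ultimately show ?thesis using that by blast
qed

text \<open>Second-order expansion of the one-step exponential moment: the linear term produces the
  drift of \<open>u\<close>, the bounded increments control the quadratic one. Negative
  \<open>t\<close> serves the contraction, both signs serve the tail estimates.\<close>

lemma Q_exp_le:
  assumes u: "cont_off_0 u" and x: "x \<noteq> 0"
    and C: "\<And>l. l \<in> msupp \<nu> \<Longrightarrow> \<bar>u (A l x) - u x\<bar> \<le> C" and t: "\<bar>t\<bar> * C \<le> 1"
  shows "Q (\<lambda>x. exp (t * u x)) x \<le> exp (t * u x) * exp (t * (Q u x - u x) + (t * C)\<^sup>2)"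
proof -
  let ?c = "1 - t * u x + (t * C)\<^sup>2"
  have pt: "exp (t * u y) \<le> exp (t * u x) * (?c + t * u y)" if y: "\<bar>u y - u x\<bar> \<le> C" for y
  proof -
    have le: "\<bar>t * (u y - u x)\<bar> \<le> \<bar>t\<bar> * C" using y by (simp add: abs_mult mult_left_mono)
    then have "exp (t * (u y - u x)) \<le> 1 + t * (u y - u x) + (t * (u y - u x))\<^sup>2"
      using t by (intro exp_le_quadratic) linarith
    also have "(t * (u y - u x))\<^sup>2 \<le> (t * C)\<^sup>2"
      using power_mono[OF le, of 2] by (simp add: power_mult_distrib)
    finally have "exp (t * u x) * exp (t * (u y - u x)) \<le> exp (t * u x) * (?c + t * u y)"
      by (intro mult_left_mono) (auto simp: algebra_simps)
    then show ?thesis by (simp add: exp_add[symmetric] algebra_simps)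
  qed
  have c1: "cont_off_0 (\<lambda>y. exp (t * u y))" by (intro continuous_intros u)
  have c2: "cont_off_0 (\<lambda>y. ?c + t * u y)" by (intro continuous_intros u)
  have "Q (\<lambda>y. exp (t * u y)) x \<le> Q (\<lambda>y. exp (t * u x) * (?c + t * u y)) x"
    using pt C by (intro Q_mono c1 continuous_on_mult continuous_on_const c2) auto
  also have "\<dots> = exp (t * u x) * (?c + t * Q u x)"
    by (subst Q_cmult, subst Q_add) (intro continuous_intros u, simp_all add: Q_const Q_cmult continuous_intros u)
  also have "\<dots> \<le> exp (t * u x) * exp (t * (Q u x - u x) + (t * C)\<^sup>2)"
    using exp_ge_add_one_self[of "t * (Q u x - u x) + (t * C)\<^sup>2"]
    by (intro mult_left_mono) (auto simp: algebra_simps)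
  finally show ?thesis .
qed

lemma Q_iter_le_geometric:
  assumes v: "cont_off_0 v" and le: "\<And>x. x \<noteq> 0 \<Longrightarrow> Q v x \<le> r * v x" and r: "r \<ge> 0" and x: "x \<noteq> 0"
  shows "(Q ^^ k) v x \<le> r ^ k * v x"
  using x
proof (induction k arbitrary: x)
  case (Suc k)
  have "Q ((Q ^^ k) v) x \<le> Q (\<lambda>x. r ^ k * v x) x"
    using Suc by (intro Q_mono' cont_off_0_Q_iter continuous_on_mult continuous_on_const v) auto
  also have "\<dots> = r ^ k * Q v x" by (simp add: Q_cmult)
  also have "\<dots> \<le> r ^ k * (r * v x)" using r le Suc by (intro mult_left_mono) auto
  finally show ?case by (simp add: algebra_simps)
qed simp

lemma Q_iter_ge_const:
  assumes v: "cont_off_0 v" and le: "\<And>x. x \<noteq> 0 \<Longrightarrow> c \<le> v x" and x: "x \<noteq> 0"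
  shows "c \<le> (Q ^^ k) v x"
  using x
proof (induction k arbitrary: x)
  case (Suc k)
  have "Q (\<lambda>_. c) x \<le> Q ((Q ^^ k) v) x"
    using Suc by (intro Q_mono' cont_off_0_Q_iter v) auto
  then show ?case by (simp add: Q_const)
qed (use le in auto)

lemma Q_iter_sum:
  assumes "\<And>i. i \<in> I \<Longrightarrow> cont_off_0 (f i)"
  shows "(Q ^^ k) (\<lambda>x. \<Sum>i\<in>I. f i x) = (\<lambda>x. \<Sum>i\<in>I. (Q ^^ k) (f i) x)"
proof (induction k)
  case (Suc k)
  then show ?case using assms by (simp add: Q_sum cont_off_0_Q_iter)
qed simp

text \<open>For unit vectors the difference of squared norms of the images factors as the inner
  product of \<open>A l (x - y)\<close> and \<open>A l (x + y)\<close>, hence is at most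
  \<open>2 * C^2 * |wedge x y|\<close>. The bound \<open>1 / C\<close> from below on
  \<open>cmod (A l y)\<close> supplies the other two powers of \<open>C\<close>.\<close>

lemma drift_lipschitz:
  obtains c where "c > 0"
    "\<And>x y. x \<noteq> 0 \<Longrightarrow> y \<noteq> 0 \<Longrightarrow> \<bar>drift x - drift y\<bar> \<le> c * (\<bar>wedge x y\<bar> / (cmod x * cmod y))"
proof -
  obtain C where C: "C \<ge> 1" "\<And>l x. l \<in> msupp \<nu> \<Longrightarrow> cmod (A l x) \<le> C * cmod x"
    "\<And>l x. l \<in> msupp \<nu> \<Longrightarrow> cmod x \<le> C * cmod (A l x)" using A_bounds by blast
  have one: "ln (cmod (A l x)) - ln (cmod (A l y)) \<le> C ^ 4 * \<bar>wedge x y\<bar>"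
    if l: "l \<in> msupp \<nu>" and x: "cmod x = 1" "cmod y = 1" for l x y
  proof -
    have nz: "A l x \<noteq> 0" "A l y \<noteq> 0" using x by auto
    have "2 * (ln (cmod (A l x)) - ln (cmod (A l y))) = ln ((cmod (A l x))\<^sup>2) - ln ((cmod (A l y))\<^sup>2)"
      using nz by (simp add: ln_realpow)
    also have "\<dots> \<le> ((cmod (A l x))\<^sup>2 - (cmod (A l y))\<^sup>2) / (cmod (A l y))\<^sup>2"
      using nz by (intro ln_diff_le) auto
    also have "(cmod (A l x))\<^sup>2 - (cmod (A l y))\<^sup>2 = (A l x - A l y) \<bullet> (A l x + A l y)"
      by (simp add: power2_norm_eq_inner inner_simps inner_commute[of "A l x" "A l y"])
    also have "A l x - A l y = A l (x - y)" using linear_A linear_diff by metis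
    also have "A l x + A l y = A l (x + y)" using linear_A linear_add by metis
    also have "(A l (x - y) \<bullet> A l (x + y)) / (cmod (A l y))\<^sup>2 \<le> (2 * C\<^sup>2 * \<bar>wedge x y\<bar>) * C\<^sup>2"
    proof -
      have "A l (x - y) \<bullet> A l (x + y) \<le> cmod (A l (x - y)) * cmod (A l (x + y))" by (rule norm_cauchy_schwarz)
      also have "\<dots> \<le> (C * cmod (x - y)) * (C * cmod (x + y))"
        using C l by (intro mult_mono) auto
      also have "\<dots> = C\<^sup>2 * (cmod (x - y) * cmod (x + y))" by (simp add: power2_eq_square)
      also have "\<dots> = 2 * C\<^sup>2 * \<bar>wedge x y\<bar>" by (simp add: cmod_diff_times_sum[OF x])
      finally have 1: "A l (x - y) \<bullet> A l (x + y) \<le> 2 * C\<^sup>2 * \<bar>wedge x y\<bar>" .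
      have "1 \<le> (C * cmod (A l y))\<^sup>2" using C(3)[OF l, of y] x one_le_power by simp
      then have 2: "1 / (cmod (A l y))\<^sup>2 \<le> C\<^sup>2" using nz by (simp add: power_mult_distrib field_simps)
      have "(A l (x - y) \<bullet> A l (x + y)) * (1 / (cmod (A l y))\<^sup>2) \<le> (2 * C\<^sup>2 * \<bar>wedge x y\<bar>) * C\<^sup>2"
        using 1 2 by (intro mult_mono) auto
      then show ?thesis by simp
    qed
    finally have "2 * (ln (cmod (A l x)) - ln (cmod (A l y))) \<le> 2 * C ^ 4 * \<bar>wedge x y\<bar>"
      by (simp add: power2_eq_square power4_eq_xxxx algebra_simps)
    then show ?thesis by simp
  qed
  have unit: "drift x - drift y \<le> C ^ 4 * \<bar>wedge x y\<bar>" if "cmod x = 1" "cmod y = 1" for x y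
  proof -
    have "drift x - drift y = (\<integral>l. ln (cmod (A l x)) - ln (cmod (A l y)) \<partial>\<nu>)"
      using that integrable_cont_off_0[OF cont_off_0_ln_cmod] by (simp add: drift_def Q_def)
    also have "\<dots> \<le> (\<integral>l. C ^ 4 * \<bar>wedge x y\<bar> \<partial>\<nu>)"
      using one that AE_in_msupp integrable_cont_off_0[OF cont_off_0_ln_cmod]
      by (intro integral_mono_AE) auto
    finally show ?thesis by simp
  qed
  have "\<bar>drift x - drift y\<bar> \<le> C ^ 4 * (\<bar>wedge x y\<bar> / (cmod x * cmod y))" if "x \<noteq> 0" "y \<noteq> 0" for x y
  proof -
    have "sgn x = of_real (1 / cmod x) * x" "sgn y = of_real (1 / cmod y) * y"
      by (simp_all add: sgn_div_norm scaleR_conv_of_real divide_inverse)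
    then have w: "\<bar>wedge (sgn x) (sgn y)\<bar> = \<bar>wedge x y\<bar> / (cmod x * cmod y)"
      by (simp add: abs_mult del: of_real_divide)
    have "cmod (sgn x) = 1" "cmod (sgn y) = 1" using that by (simp_all add: norm_sgn)
    then have "\<bar>drift (sgn x) - drift (sgn y)\<bar> \<le> C ^ 4 * \<bar>wedge (sgn x) (sgn y)\<bar>"
      using unit[of "sgn x" "sgn y"] unit[of "sgn y" "sgn x"] wedge_commute[of "sgn x" "sgn y"] by simp
    then show ?thesis unfolding w using homog0_sgn[OF homog0_drift] that by simp
  qed
  then show ?thesis using that[of "C ^ 4"] C(1) by simp
qed

end

section \<open>Uniform growth and contraction on the projective line\<close>

locale irreducible_sl2_random_walk = sl2_random_walk +
  assumes no_invariant_form: "\<exists>l\<in>msupp \<nu>. \<exists>x. qform q (A l x) \<noteq> qform q x"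
    and no_invariant_lines:
      "x \<noteq> 0 \<Longrightarrow> y \<noteq> 0 \<Longrightarrow> \<exists>l\<in>msupp \<nu>. wedge x (A l x) \<noteq> 0 \<and> wedge x (A l y) \<noteq> 0"
begin

text \<open>One \<open>n\<close> serves all \<open>x\<close>: otherwise every \<open>n\<close> has a
  bad starting point, and these feed \<open>ex_stationary\<close>. The two locale hypotheses exclude
  both alternatives for the resulting measure.\<close>

lemma ex_uniform_growth: "\<exists>n. \<forall>x. x \<noteq> 0 \<longrightarrow> ln (cmod x) < (Q ^^ Suc n) (\<lambda>x. ln (cmod x)) x"
proof (rule ccontr)
  assume "\<not> ?thesis"
  then have "\<exists>x. x \<noteq> 0 \<and> (Q ^^ Suc n) (\<lambda>x. ln (cmod x)) x \<le> ln (cmod x)" for n by (meson not_less)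
  then obtain \<mu> where \<mu>: "real_distribution \<mu>"
    "\<And>g. cont_off_0 g \<Longrightarrow> homog0 g \<Longrightarrow> (\<integral>\<theta>. Q g (cis \<theta>) \<partial>\<mu>) = (\<integral>\<theta>. g (cis \<theta>) \<partial>\<mu>)"
    "(\<integral>\<theta>. drift (cis \<theta>) \<partial>\<mu>) \<le> 0" using ex_stationary by blast
  interpret S: sl2_stationary \<nu> A \<mu>
    using sl2_family_axioms \<mu> by (intro sl2_stationary.intro sl2_stationary_axioms.intro) auto
  show False
  proof (cases "\<forall>x. x \<noteq> 0 \<longrightarrow> S.line_mass x < 1/2")
    case True
    then show False using S.ex_invariant_form no_invariant_form by blast
  next
    case False
    then show False using S.heavy_line_imp_invariant_lines no_invariant_lines by (meson not_less)
  qed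
qed

text \<open>Averaging \<open>Q^k ln\<close> over \<open>k < N\<close> turns growth over
  \<open>N\<close> steps into growth at each step: the one-step drift of the average telescopes to
  \<open>b / N\<close>, and \<open>b\<close> has a positive minimum by compactness. The bound on the
  sums of drifts is kept for the positivity of the limit.\<close>

lemma ex_corrector:
  "\<exists>h \<delta> N. cont_off_0 h \<and> homog0 h \<and> \<delta> > 0 \<and> N > 0 \<and>
    (\<forall>x. x \<noteq> 0 \<longrightarrow> \<delta> \<le> Q (\<lambda>x. ln (cmod x) + h x) x - (ln (cmod x) + h x)) \<and>
    (\<forall>x. x \<noteq> 0 \<longrightarrow> \<delta> \<le> (\<Sum>k<N. (Q ^^ k) drift x))"
proof -
  obtain n where n: "\<And>x. x \<noteq> 0 \<Longrightarrow> ln (cmod x) < (Q ^^ Suc n) (\<lambda>x. ln (cmod x)) x"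
    using ex_uniform_growth by blast
  let ?ln = "\<lambda>x. ln (cmod x)"
  define N where "N = Suc n"
  have itc: "cont_off_0 ((Q ^^ k) drift)" and ith: "homog0 ((Q ^^ k) drift)" for k
    by (auto intro: cont_off_0_Q_iter homog0_Q_iter cont_off_0_drift homog0_drift)
  define b where "b x = (\<Sum>k<N. (Q ^^ k) drift x)" for x
  have bc: "cont_off_0 b" unfolding b_def [abs_def] by (intro continuous_intros itc)
  have bh: "homog0 b" using ith unfolding b_def [abs_def] homog0_def by simp
  obtain x0 where x0: "x0 \<noteq> 0" "\<And>x. x \<noteq> 0 \<Longrightarrow> b x0 \<le> b x" using homog0_attains_inf[OF bc bh] by blast
  have b0: "b x0 > 0" using n[OF x0(1)] unfolding Q_iter_ln b_def N_def by simp
  define h where "h x = (\<Sum>k<N. \<Sum>j<k. (Q ^^ j) drift x) / real N" for x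
  have N0: "real N > 0" by (simp add: N_def)
  have hc: "cont_off_0 h" unfolding h_def [abs_def] using N0 by (intro continuous_intros itc) auto
  have hh: "homog0 h" using ith unfolding h_def [abs_def] homog0_def by simp
  have W: "(\<lambda>x. ln (cmod x) + h x) = (\<lambda>x. (1 / real N) * (\<Sum>k<N. (Q ^^ k) ?ln x))"
  proof
    fix x
    have "(\<Sum>k<N. (Q ^^ k) ?ln x) = real N * ln (cmod x) + real N * h x"
      using N0 by (simp add: Q_iter_ln sum.distrib h_def)
    then show "ln (cmod x) + h x = (1 / real N) * (\<Sum>k<N. (Q ^^ k) ?ln x)"
      using N0 by (simp add: field_simps)
  qed
  have QW: "Q (\<lambda>x. ln (cmod x) + h x) x - (ln (cmod x) + h x) = b x / real N" for x
  proof -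
    have "Q (\<lambda>x. ln (cmod x) + h x) x = (1 / real N) * (\<Sum>k<N. (Q ^^ Suc k) ?ln x)"
      unfolding W Q_cmult using cont_off_0_Q_iter[OF cont_off_0_ln_cmod] by (simp add: Q_sum)
    moreover have "(\<Sum>k<N. (Q ^^ Suc k) ?ln x) - (\<Sum>k<N. (Q ^^ k) ?ln x) = b x"
    proof -
      have "(\<Sum>k<N. (Q ^^ Suc k) ?ln x - (Q ^^ k) ?ln x) = (Q ^^ N) ?ln x - (Q ^^ 0) ?ln x"
        by (rule sum_lessThan_telescope)
      also have "\<dots> = b x" by (simp add: Q_iter_ln b_def)
      finally show ?thesis by (simp only: sum_subtractf)
    qed
    moreover have "ln (cmod x) + h x = (1 / real N) * (\<Sum>k<N. (Q ^^ k) ?ln x)"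
      using W by (rule fun_cong)
    ultimately show ?thesis by (simp add: diff_divide_distrib[symmetric])
  qed
  \<comment> \<open>A single constant \<open>b x0 / N\<close> then serves both bounds.\<close>
  have le: "b x0 / real N \<le> b x0" using b0 by (simp add: N_def field_simps)
  show ?thesis
  proof (intro exI[of _ h] exI[of _ "b x0 / real N"] exI[of _ N] conjI allI impI hc hh)
    show "b x0 / real N > 0" using b0 N0 by simp
    show "N > 0" by (simp add: N_def)
  next
    fix x :: complex assume x: "x \<noteq> 0"
    show "b x0 / real N \<le> Q (\<lambda>x. ln (cmod x) + h x) x - (ln (cmod x) + h x)"
      unfolding QW using x0(2)[OF x] N0 by (simp add: divide_right_mono)
  next
    fix x :: complex assume x: "x \<noteq> 0"
    show "b x0 / real N \<le> (\<Sum>k<N. (Q ^^ k) drift x)"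
      using le x0(2)[OF x] by (simp add: b_def)
  qed
qed

text \<open>The corrected distance \<open>|wedge x y| powr s * exp (- s * (W x + W y))\<close> is contracted on average
  because \<open>wedge\<close> is invariant and \<open>W\<close> has positive drift.\<close>

lemma Q_iter_drift_oscillation:
  "\<exists>K \<rho>. 0 \<le> \<rho> \<and> \<rho> < 1 \<and> (\<forall>n x y. x \<noteq> 0 \<longrightarrow> y \<noteq> 0 \<longrightarrow>
    \<bar>(Q ^^ n) drift x - (Q ^^ n) drift y\<bar> \<le> K * \<rho> ^ n)"
proof -
  obtain h \<delta> where hc: "cont_off_0 h" and hh: "homog0 h" and \<delta>: "\<delta> > 0"
    and Wdrift: "\<And>x. x \<noteq> 0 \<Longrightarrow> \<delta> \<le> Q (\<lambda>x. ln (cmod x) + h x) x - (ln (cmod x) + h x)"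
    using ex_corrector by blast
  define W where "W x = ln (cmod x) + h x" for x
  have Wc: "cont_off_0 W" unfolding W_def [abs_def] by (intro continuous_on_add cont_off_0_ln_cmod hc)
  obtain C where C: "C > 0" "\<And>l x. l \<in> msupp \<nu> \<Longrightarrow> x \<noteq> 0 \<Longrightarrow> \<bar>W (A l x) - W x\<bar> \<le> C"
    using ex_increment_bound[OF hc hh] unfolding W_def by metis
  obtain B where B: "\<And>x. x \<noteq> 0 \<Longrightarrow> \<bar>h x\<bar> \<le> B" using homog0_bounded[OF hc hh] by blast
  \<comment> \<open>\<open>s \<le> 1\<close> gives \<open>r \<le> r powr s\<close> for
    \<open>r\<close> in \<open>[0, 1]\<close>, \<open>2 * s * C \<le> 1\<close> admits
    \<open>Q_exp_le\<close> at \<open>t = - 2 * s\<close>, and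
    \<open>4 * s * C^2 \<le> \<delta>\<close> lets the quadratic term use up half of the gain
    \<open>2 * s * \<delta>\<close>.\<close>
  define s where "s = min 1 (min (1 / (2 * C)) (\<delta> / (4 * C\<^sup>2)))"
  have s: "s > 0" "s \<le> 1" "2 * s * C \<le> 1" "4 * s * C\<^sup>2 \<le> \<delta>"
  proof -
    show "s > 0" using C(1) \<delta> by (simp add: s_def)
    show "s \<le> 1" by (simp add: s_def)
    have "s \<le> 1 / (2 * C)" "s \<le> \<delta> / (4 * C\<^sup>2)" by (simp_all add: s_def)
    then show "2 * s * C \<le> 1" "4 * s * C\<^sup>2 \<le> \<delta>" using C(1) by (simp_all add: field_simps)
  qed
  define \<rho> where "\<rho> = exp (- (s * \<delta>))"
  have \<rho>: "0 \<le> \<rho>" "\<rho> < 1" using s \<delta> by (simp_all add: \<rho>_def)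
  have Qexp: "Q (\<lambda>x. exp (- 2 * s * W x)) x \<le> exp (- 2 * s * W x) * \<rho>" if x: "x \<noteq> 0" for x
  proof -
    have "Q (\<lambda>x. exp (- 2 * s * W x)) x
       \<le> exp (- 2 * s * W x) * exp ((- 2 * s) * (Q W x - W x) + (- 2 * s * C)\<^sup>2)"
      using s C(2) x by (intro Q_exp_le Wc) auto
    also have "(- 2 * s) * (Q W x - W x) + (- 2 * s * C)\<^sup>2 \<le> - (s * \<delta>)"
    proof -
      have "s * \<delta> \<le> s * (Q W x - W x)"
        using Wdrift[OF x] s(1) unfolding W_def [abs_def] by (intro mult_left_mono) auto
      moreover have "(- 2 * s * C)\<^sup>2 = s * (4 * s * C\<^sup>2)" by (simp add: power2_eq_square)
      moreover have "s * (4 * s * C\<^sup>2) \<le> s * \<delta>" using s by (intro mult_left_mono) auto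
      ultimately show ?thesis by simp
    qed
    finally show ?thesis by (simp add: \<rho>_def)
  qed
  define d where "d x y = \<bar>wedge x y\<bar> powr s * exp (- s * (W x + W y))" for x y
  have d0: "d x y \<ge> 0" for x y by (simp add: d_def)
  have step: "\<bar>Q g x - Q g y\<bar> \<le> (H * \<rho>) * d x y"
    if g: "cont_off_0 g" and H: "H \<ge> 0" "\<And>x y. x \<noteq> 0 \<Longrightarrow> y \<noteq> 0 \<Longrightarrow> \<bar>g x - g y\<bar> \<le> H * d x y"
      and xy: "x \<noteq> 0" "y \<noteq> 0" for g H x y
  proof -
    define e where "e z l = exp (2 * s * W z) * exp (- 2 * s * W (A l z))" for z l
    have ec: "cont_off_0 (\<lambda>z. exp (- 2 * s * W z))" by (intro continuous_intros Wc)
    have e_int: "integrable \<nu> (e z)" for z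
      unfolding e_def using integrable_cont_off_0[OF ec] by simp
    have e_le: "(\<integral>l. e z l \<partial>\<nu>) \<le> \<rho>" if "z \<noteq> 0" for z
    proof -
      have "(\<integral>l. e z l \<partial>\<nu>) = exp (2 * s * W z) * Q (\<lambda>x. exp (- 2 * s * W x)) z"
        unfolding e_def Q_def by simp
      also have "\<dots> \<le> exp (2 * s * W z) * (exp (- 2 * s * W z) * \<rho>)"
        using Qexp[OF that] by (intro mult_left_mono) auto
      also have "\<dots> = \<rho>" by (simp add: mult.assoc[symmetric] exp_add[symmetric])
      finally show ?thesis .
    qed
    \<comment> \<open>Invariance of \<open>wedge\<close> makes the ratio of distances a product
      \<open>a * b\<close> of one factor per point. The bound by half the sum of squares decouples
      them, so only one-point exponential moments are needed.\<close>
    have de: "d (A l x) (A l y) \<le> d x y * ((e x l + e y l) / 2)" for l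
    proof -
      define a where "a = exp (s * W x) * exp (- s * W (A l x))"
      define b where "b = exp (s * W y) * exp (- s * W (A l y))"
      have "d (A l x) (A l y) = d x y * (a * b)"
        by (simp add: d_def wedge_A a_def b_def exp_add[symmetric] mult.assoc algebra_simps)
      also have "\<dots> \<le> d x y * ((a\<^sup>2 + b\<^sup>2) / 2)"
        using sum_squares_bound[of a b] d0 by (intro mult_left_mono) auto
      also have "a\<^sup>2 = e x l"
        by (simp add: a_def e_def power2_eq_square exp_add[symmetric] algebra_simps)
      also have "b\<^sup>2 = e y l"
        by (simp add: b_def e_def power2_eq_square exp_add[symmetric] algebra_simps)
      finally show ?thesis .
    qed
    have gi: "integrable \<nu> (\<lambda>l. g (A l z))" for z by (rule integrable_cont_off_0[OF g])
    have "\<bar>Q g x - Q g y\<bar> = \<bar>\<integral>l. g (A l x) - g (A l y) \<partial>\<nu>\<bar>" unfolding Q_def using gi by simp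
    also have "\<dots> \<le> (\<integral>l. \<bar>g (A l x) - g (A l y)\<bar> \<partial>\<nu>)" by (rule integral_abs_bound)
    also have "\<dots> \<le> (\<integral>l. H * d x y / 2 * (e x l + e y l) \<partial>\<nu>)"
    proof (rule integral_mono)
      fix l
      have "\<bar>g (A l x) - g (A l y)\<bar> \<le> H * d (A l x) (A l y)" using H(2) xy by simp
      also have "\<dots> \<le> H * (d x y * ((e x l + e y l) / 2))" using de H(1) by (intro mult_left_mono)
      finally show "\<bar>g (A l x) - g (A l y)\<bar> \<le> H * d x y / 2 * (e x l + e y l)" by simp
    qed (use gi e_int in auto)
    also have "\<dots> = H * d x y / 2 * ((\<integral>l. e x l \<partial>\<nu>) + (\<integral>l. e y l \<partial>\<nu>))" using e_int by simp
    also have "\<dots> \<le> H * d x y / 2 * (\<rho> + \<rho>)"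
      using e_le xy d0 H(1) by (intro mult_left_mono add_mono) auto
    finally show ?thesis by (simp add: algebra_simps)
  qed
  obtain c where c: "c > 0"
    "\<And>x y. x \<noteq> 0 \<Longrightarrow> y \<noteq> 0 \<Longrightarrow> \<bar>drift x - drift y\<bar> \<le> c * (\<bar>wedge x y\<bar> / (cmod x * cmod y))"
    using drift_lipschitz by blast
  define H where "H = c * exp (2 * s * B)"
  have H0: "H \<ge> 0" using c by (simp add: H_def)
  have base: "\<bar>drift x - drift y\<bar> \<le> H * d x y" if xy: "x \<noteq> 0" "y \<noteq> 0" for x y
  proof -
    \<comment> \<open>The sine of the angle between \<open>x\<close> and \<open>y\<close>, at most
      1. Passing from \<open>ln (cmod x)\<close> to \<open>W\<close> costs only the factor
      \<open>exp (2 * s * B)\<close>, because \<open>h\<close> is bounded.\<close>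
    define r where "r = \<bar>wedge x y\<bar> / (cmod x * cmod y)"
    have r: "0 \<le> r" "r \<le> 1" using abs_wedge_le[of x y] xy by (auto simp: r_def divide_le_eq_1)
    have req: "r = \<bar>wedge x y\<bar> * exp (- (ln (cmod x) + ln (cmod y)))"
      unfolding exp_minus exp_add using xy by (simp add: r_def divide_inverse)
    have "r \<le> r powr s"
    proof (cases "r = 0")
      case False
      then have "r powr 1 \<le> r powr s" using r s by (intro powr_mono') auto
      then show ?thesis using r by simp
    qed simp
    also have "r powr s = \<bar>wedge x y\<bar> powr s * exp (- s * (ln (cmod x) + ln (cmod y)))"
      unfolding req by (simp add: powr_mult exp_powr_real algebra_simps)
    also have "exp (- s * (ln (cmod x) + ln (cmod y))) \<le> exp (2 * s * B) * exp (- s * (W x + W y))"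
    proof -
      have "s * (h x + h y) \<le> s * (2 * B)" using B[OF xy(1)] B[OF xy(2)] s by (intro mult_left_mono) auto
      then show ?thesis unfolding exp_add[symmetric] by (simp add: W_def algebra_simps)
    qed
    finally have "r \<le> \<bar>wedge x y\<bar> powr s * (exp (2 * s * B) * exp (- s * (W x + W y)))"
      by (simp add: mult_left_mono)
    then have "c * r \<le> c * (exp (2 * s * B) * d x y)"
      using c(1) by (intro mult_left_mono) (auto simp: d_def algebra_simps)
    then show ?thesis using c(2)[OF xy] by (simp add: r_def H_def algebra_simps)
  qed
  have iter: "\<bar>(Q ^^ n) drift x - (Q ^^ n) drift y\<bar> \<le> (H * \<rho> ^ n) * d x y" if "x \<noteq> 0" "y \<noteq> 0" for n x y
    using that
  proof (induction n arbitrary: x y)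
    case (Suc n)
    have "\<bar>Q ((Q ^^ n) drift) x - Q ((Q ^^ n) drift) y\<bar> \<le> (H * \<rho> ^ n * \<rho>) * d x y"
      using H0 \<rho> Suc by (intro step cont_off_0_Q_iter cont_off_0_drift) auto
    then show ?case by (simp add: algebra_simps)
  qed (use base in simp)
  define K where "K = H * exp (2 * s * B)"
  have "\<bar>(Q ^^ n) drift x - (Q ^^ n) drift y\<bar> \<le> K * \<rho> ^ n" if xy: "x \<noteq> 0" "y \<noteq> 0" for n x y
  proof -
    \<comment> \<open>Both sides depend only on directions, and for unit vectors \<open>d\<close> is
      bounded.\<close>
    have n1: "cmod (sgn x) = 1" "cmod (sgn y) = 1" using xy by (simp_all add: norm_sgn)
    have nz: "sgn x \<noteq> 0" "sgn y \<noteq> 0" using xy by (simp_all add: sgn_eq_0_iff)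
    have "d (sgn x) (sgn y) \<le> 1 * exp (2 * s * B)"
      unfolding d_def
    proof (rule mult_mono)
      have "\<bar>wedge (sgn x) (sgn y)\<bar> \<le> 1" using abs_wedge_le[of "sgn x" "sgn y"] n1 by simp
      then show "\<bar>wedge (sgn x) (sgn y)\<bar> powr s \<le> 1" using s(1) by (simp add: powr_le1)
      have "s * (- (W (sgn x) + W (sgn y))) \<le> s * (2 * B)"
        using B[OF nz(1)] B[OF nz(2)] s(1) n1 by (intro mult_left_mono) (auto simp: W_def)
      then show "exp (- s * (W (sgn x) + W (sgn y))) \<le> exp (2 * s * B)" by (simp add: algebra_simps)
    qed auto
    then have "(H * \<rho> ^ n) * d (sgn x) (sgn y) \<le> (H * \<rho> ^ n) * (1 * exp (2 * s * B))"
      using H0 \<rho> by (intro mult_left_mono) auto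
    moreover have "homog0 ((Q ^^ n) drift)" by (intro homog0_Q_iter homog0_drift)
    ultimately show ?thesis
      using iter[OF nz, of n] xy by (simp add: homog0_sgn K_def algebra_simps)
  qed
  then show ?thesis using \<rho> by blast
qed

text \<open>\<open>Q\<close> is an average, so the next iterate at 1 lies within the oscillation of
  the current one. The oscillations are summable, so the values at 1 converge, and all other
  directions follow uniformly.\<close>

lemma ex_lyapunov_limit:
  "\<exists>L>0. \<forall>\<epsilon>>0. \<exists>n. \<forall>x. x \<noteq> 0 \<longrightarrow> \<bar>(Q ^^ n) drift x - L\<bar> \<le> \<epsilon>"
proof -
  obtain K \<rho> where \<rho>: "0 \<le> \<rho>" "\<rho> < 1"
    and osc: "\<And>n x y. x \<noteq> 0 \<Longrightarrow> y \<noteq> 0 \<Longrightarrow> \<bar>(Q ^^ n) drift x - (Q ^^ n) drift y\<bar> \<le> K * \<rho> ^ n"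
    using Q_iter_drift_oscillation by blast
  have itc: "cont_off_0 ((Q ^^ k) drift)" for k by (intro cont_off_0_Q_iter cont_off_0_drift)
  define c where "c n = (Q ^^ n) drift 1" for n
  have "\<bar>c (Suc n) - c n\<bar> \<le> K * \<rho> ^ n" for n
  proof -
    have "Q ((Q ^^ n) drift) 1 \<le> Q (\<lambda>_. c n + K * \<rho> ^ n) 1" "Q (\<lambda>_. c n - K * \<rho> ^ n) 1 \<le> Q ((Q ^^ n) drift) 1"
      using osc[of _ 1 n] itc by (auto intro!: Q_mono' simp: c_def abs_le_iff algebra_simps minus_le_iff)
    then show ?thesis by (simp add: Q_const c_def abs_le_iff)
  qed
  moreover have geo: "summable (\<lambda>n. K * \<rho> ^ n)" using \<rho> by (intro summable_mult summable_geometric) simp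
  ultimately have "summable (\<lambda>n. c (Suc n) - c n)" by (intro summable_comparison_test'[OF geo]) auto
  then have "(\<lambda>n. \<Sum>k<n. c (Suc k) - c k) \<longlonglongrightarrow> suminf (\<lambda>n. c (Suc n) - c n)" by (rule summable_LIMSEQ)
  then have "(\<lambda>n. (\<Sum>k<n. c (Suc k) - c k) + c 0) \<longlonglongrightarrow> suminf (\<lambda>n. c (Suc n) - c n) + c 0"
    by (intro tendsto_intros)
  moreover define L where "L = suminf (\<lambda>n. c (Suc n) - c n) + c 0"
  ultimately have cL: "c \<longlonglongrightarrow> L" by (simp add: sum_lessThan_telescope)
  have unif: "\<forall>\<^sub>F n in sequentially. \<forall>x. x \<noteq> 0 \<longrightarrow> \<bar>(Q ^^ n) drift x - L\<bar> \<le> \<epsilon>" if "\<epsilon> > 0" for \<epsilon>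
  proof -
    have "(\<lambda>n. K * \<rho> ^ n) \<longlonglongrightarrow> 0" using geo by (rule summable_LIMSEQ_zero)
    then have "\<forall>\<^sub>F n in sequentially. K * \<rho> ^ n < \<epsilon> / 2" using that order_tendstoD(2)[of _ 0] by (metis half_gt_zero)
    moreover have "\<forall>\<^sub>F n in sequentially. \<bar>c n - L\<bar> < \<epsilon> / 2"
      using cL that tendstoD[OF cL, of "\<epsilon> / 2"] by (simp add: dist_real_def)
    ultimately show ?thesis
    proof eventually_elim
      case (elim n)
      show ?case
      proof (intro allI impI)
        fix x :: complex assume "x \<noteq> 0"
        then have "\<bar>(Q ^^ n) drift x - c n\<bar> \<le> K * \<rho> ^ n" unfolding c_def by (intro osc) auto
        then show "\<bar>(Q ^^ n) drift x - L\<bar> \<le> \<epsilon>" using elim by linarith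
      qed
    qed
  qed
  obtain \<delta> N where \<delta>: "\<delta> > 0" "N > 0"
    and \<delta>_sum: "\<And>x. x \<noteq> 0 \<Longrightarrow> \<delta> \<le> (\<Sum>k<N. (Q ^^ k) drift x)"
    using ex_corrector by blast
  \<comment> \<open>Any \<open>N\<close> consecutive values sum to at least \<open>\<delta>\<close>,
    since \<open>Q^m\<close> preserves the lower bound. In the limit
    \<open>N * L \<ge> \<delta>\<close>, which excludes \<open>L = 0\<close>.\<close>
  have "\<delta> \<le> (\<Sum>k<N. c (m + k))" for m
  proof -
    have "\<delta> \<le> (Q ^^ m) (\<lambda>x. \<Sum>k<N. (Q ^^ k) drift x) 1"
      using \<delta>_sum by (intro Q_iter_ge_const) (auto intro!: continuous_intros itc)
    then show ?thesis using itc by (simp add: Q_iter_sum c_def funpow_add)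
  qed
  moreover have "(\<lambda>m. \<Sum>k<N. c (m + k)) \<longlonglongrightarrow> (\<Sum>k<N. L)"
    by (intro tendsto_sum LIMSEQ_ignore_initial_segment cL)
  ultimately have "\<delta> \<le> (\<Sum>k<N. L)" by (intro LIMSEQ_le_const) auto
  then have "0 < real N * L" using \<delta>(1) by simp
  then have "L > 0" using \<delta>(2) by (simp add: zero_less_mult_iff)
  then show ?thesis
  proof (intro exI[of _ L] conjI allI impI)
    fix \<epsilon> :: real assume "\<epsilon> > 0"
    from eventually_happens[OF unif[OF this]]
    show "\<exists>n. \<forall>x. x \<noteq> 0 \<longrightarrow> \<bar>(Q ^^ n) drift x - L\<bar> \<le> \<epsilon>" by auto
  qed
qed

end

section \<open>Almost sure convergence\<close>

lemma (in prob_space) AE_eventually_less_1: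
  fixes X :: "nat \<Rightarrow> 'a \<Rightarrow> real"
  assumes int: "\<And>k. integrable M (X k)" and nn: "\<And>k \<omega>. 0 \<le> X k \<omega>"
    and le: "\<And>k. (\<integral>\<omega>. X k \<omega> \<partial>M) \<le> c * r ^ k" and r: "0 \<le> r" "r < 1"
  shows "AE \<omega> in M. \<forall>\<^sub>F k in sequentially. X k \<omega> < 1"
proof -
  define B where "B k = {\<omega> \<in> space M. 1 \<le> X k \<omega>}" for k
  have Bs: "B k \<in> sets M" for k
    unfolding B_def using int[of k] by measurable
  have bd: "measure M (B k) \<le> c * r ^ k" for k
    using integral_Markov_inequality_measure[OF int[of k], of "{}" 1] nn le[of k] Bs[of k]
    unfolding B_def by simp
  have geo: "summable (\<lambda>k. c * r ^ k)" using r by (intro summable_mult summable_geometric) simp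
  have "summable (\<lambda>k. measure M (B k))"
  proof (rule summable_comparison_test'[OF geo])
    show "norm (measure M (B k)) \<le> c * r ^ k" if "k \<ge> 0" for k using bd[of k] by simp
  qed
  then have "AE \<omega> in M. \<forall>\<^sub>F k in sequentially. \<omega> \<in> space M - B k"
    using Bs by (intro borel_cantelli_AE1) (auto simp: emeasure_eq_measure)
  then show ?thesis
    by eventually_elim (auto simp: B_def elim!: eventually_mono)
qed

context irreducible_sl2_random_walk begin

text \<open>\<open>u\<close> equals \<open>Q^n ln\<close>, so its one-step drift is exactly
  \<open>Q^n\<close> of the drift and within \<open>\<epsilon>\<close> of \<open>L\<close>
  everywhere. Exponential moments with both signs of \<open>t\<close> bound \<open>u\<close> along
  the walk from both sides, and \<open>u\<close> differs from \<open>ln\<close> by a bounded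
  function.\<close>

lemma AE_R_growth:
  assumes x: "x \<noteq> 0" and \<epsilon>: "\<epsilon> > 0" and n: "\<And>x. x \<noteq> 0 \<Longrightarrow> \<bar>(Q ^^ n) drift x - L\<bar> \<le> \<epsilon>"
  shows "AE \<omega> in M. \<forall>\<^sub>F k in sequentially. \<bar>ln (cmod (R x k \<omega>)) / real k - L\<bar> \<le> 4 * \<epsilon>"
proof -
  define h where "h x = (\<Sum>k<n. (Q ^^ k) drift x)" for x
  define u where "u x = ln (cmod x) + h x" for x
  have itc: "cont_off_0 ((Q ^^ k) drift)" and ith: "homog0 ((Q ^^ k) drift)" for k
    by (auto intro: cont_off_0_Q_iter homog0_Q_iter cont_off_0_drift homog0_drift)
  have hc: "cont_off_0 h" unfolding h_def [abs_def] by (intro continuous_intros itc)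
  have hh: "homog0 h" using ith unfolding h_def [abs_def] homog0_def by simp
  have uc: "cont_off_0 u" unfolding u_def [abs_def] by (intro continuous_on_add cont_off_0_ln_cmod hc)
  have u_eq: "u = (Q ^^ n) (\<lambda>x. ln (cmod x))" by (simp add: fun_eq_iff u_def h_def Q_iter_ln)
  have Qu: "Q u x - u x = (Q ^^ n) drift x" for x
  proof -
    have "Q u x = (Q ^^ Suc n) (\<lambda>x. ln (cmod x)) x" by (simp add: u_eq)
    then show ?thesis unfolding Q_iter_ln by (simp add: u_def h_def)
  qed
  obtain C where C: "C > 0" "\<And>l x. l \<in> msupp \<nu> \<Longrightarrow> x \<noteq> 0 \<Longrightarrow> \<bar>u (A l x) - u x\<bar> \<le> C"
    using ex_increment_bound[OF hc hh] unfolding u_def by metis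
  \<comment> \<open>\<open>s * C \<le> 1\<close> admits \<open>Q_exp_le\<close>, and
    \<open>s * C^2 \<le> \<epsilon>\<close> makes the quadratic error at most
    \<open>s * \<epsilon>\<close>.\<close>
  define s where "s = min (1 / C) (\<epsilon> / C\<^sup>2)"
  have s: "s > 0" "s * C \<le> 1" "s * C\<^sup>2 \<le> \<epsilon>"
  proof -
    show "s > 0" using C(1) \<epsilon> by (simp add: s_def)
    have "s \<le> 1 / C" "s \<le> \<epsilon> / C\<^sup>2" by (simp_all add: s_def)
    then show "s * C \<le> 1" "s * C\<^sup>2 \<le> \<epsilon>" using C(1) by (simp_all add: field_simps)
  qed
  have tail: "AE \<omega> in M. \<forall>\<^sub>F k in sequentially. t * (u (R x k \<omega>) - real k * L) < s * (3 * \<epsilon> * real k)"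
    if t: "\<bar>t\<bar> = s" for t
  proof -
    define r where "r = exp (t * L + 2 * s * \<epsilon>)"
    define v where "v y = exp (t * u y)" for y
    have vc: "cont_off_0 v" unfolding v_def [abs_def] by (intro continuous_intros uc)
    have "Q v y \<le> r * v y" if y: "y \<noteq> 0" for y
    proof -
      have "Q v y \<le> v y * exp (t * (Q u y - u y) + (t * C)\<^sup>2)"
        unfolding v_def using C y s t by (intro Q_exp_le uc) auto
      also have "t * (Q u y - u y) + (t * C)\<^sup>2 \<le> t * L + 2 * s * \<epsilon>"
      proof -
        have "t * ((Q ^^ n) drift y - L) \<le> \<bar>t\<bar> * \<bar>(Q ^^ n) drift y - L\<bar>"
          by (metis abs_ge_self abs_mult)
        also have "\<dots> \<le> s * \<epsilon>" using t n[OF y] s(1) by (simp add: mult_left_mono)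
        finally have "t * (Q u y - u y) \<le> t * L + s * \<epsilon>" by (simp add: Qu algebra_simps)
        moreover have "(t * C)\<^sup>2 = \<bar>t\<bar>\<^sup>2 * C\<^sup>2" by (simp add: power_mult_distrib)
        moreover have "\<bar>t\<bar>\<^sup>2 * C\<^sup>2 = s * (s * C\<^sup>2)" unfolding t by (simp add: power2_eq_square)
        moreover have "s * (s * C\<^sup>2) \<le> s * \<epsilon>" using s by (intro mult_left_mono) auto
        ultimately show ?thesis by linarith
      qed
      finally show ?thesis by (simp add: r_def v_def mult.commute)
    qed
    then have it: "(Q ^^ k) v x \<le> r ^ k * v x" for k
      by (intro Q_iter_le_geometric vc x) (auto simp: r_def)
    \<comment> \<open>The moment grows at rate at most \<open>t * L + 2 * s * \<epsilon>\<close>: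
      one \<open>s * \<epsilon>\<close> for the drift error and one for the quadratic term.
      Normalising with \<open>3 * s * \<epsilon>\<close> leaves a geometric decay.\<close>
    define X where "X k \<omega> = exp (- real k * (t * L + 3 * s * \<epsilon>)) * v (R x k \<omega>)" for k \<omega>
    have "AE \<omega> in M. \<forall>\<^sub>F k in sequentially. X k \<omega> < 1"
    proof (rule M.AE_eventually_less_1[where c = "v x" and r = "exp (- (s * \<epsilon>))"])
      show "integrable M (X k)" for k unfolding X_def using integrable_R[OF vc x] by simp
      show "0 \<le> X k \<omega>" for k \<omega> by (simp add: X_def v_def)
      show "(\<integral>\<omega>. X k \<omega> \<partial>M) \<le> v x * exp (- (s * \<epsilon>)) ^ k" for k
      proof -
        have "(\<integral>\<omega>. X k \<omega> \<partial>M) = exp (- real k * (t * L + 3 * s * \<epsilon>)) * (Q ^^ k) v x"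
          unfolding X_def using integral_R[OF vc x] by simp
        also have "\<dots> \<le> exp (- real k * (t * L + 3 * s * \<epsilon>)) * (r ^ k * v x)"
          using it by (intro mult_left_mono) auto
        also have "\<dots> = v x * exp (- (s * \<epsilon>)) ^ k"
          unfolding r_def exp_of_nat_mult[symmetric]
          by (simp add: mult.assoc[symmetric] exp_add[symmetric]) (simp add: algebra_simps)
        finally show ?thesis .
      qed
    qed (use s \<epsilon> in auto)
    then show ?thesis
    proof eventually_elim
      case (elim \<omega>)
      then show ?case
      proof (rule eventually_mono)
        fix k assume "X k \<omega> < 1"
        then have "exp (t * u (R x k \<omega>) - real k * (t * L + 3 * s * \<epsilon>)) < exp 0"
          by (simp add: X_def v_def exp_add[symmetric] algebra_simps)
        then show "t * (u (R x k \<omega>) - real k * L) < s * (3 * \<epsilon> * real k)"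
          by (simp add: algebra_simps)
      qed
    qed
  qed
  obtain B where B: "\<And>x. x \<noteq> 0 \<Longrightarrow> \<bar>h x\<bar> \<le> B" using homog0_bounded[OF hc hh] by blast
  \<comment> \<open>From here on the bounded difference \<open>h\<close> costs at most one more
    \<open>\<epsilon> * k\<close>, whence \<open>4 * \<epsilon>\<close>.\<close>
  obtain k0 where k0: "B / \<epsilon> \<le> real k0" using real_arch_simple by blast
  have "\<forall>\<^sub>F k in sequentially. k \<ge> max 1 k0" by (rule eventually_ge_at_top)
  note big = this
  have "\<bar>s\<bar> = s" "\<bar>- s\<bar> = s" using s(1) by simp_all
  from tail[OF this(1)] tail[OF this(2)] show ?thesis
  proof eventually_elim
    case (elim \<omega>)
    from elim big show ?case
    proof eventually_elim
      case (elim k)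
      have k: "real k > 0" "B \<le> \<epsilon> * real k"
      proof -
        show "real k > 0" using elim by simp
        have "B / \<epsilon> \<le> real k" using elim k0 by linarith
        then show "B \<le> \<epsilon> * real k" using \<epsilon> by (simp add: field_simps)
      qed
      have "u (R x k \<omega>) - real k * L < 3 * \<epsilon> * real k" using elim(1) s(1) by (simp only: mult_less_cancel_left_pos)
      moreover have "- (u (R x k \<omega>) - real k * L) < 3 * \<epsilon> * real k"
      proof -
        have "s * (- (u (R x k \<omega>) - real k * L)) < s * (3 * \<epsilon> * real k)" 
          using elim(2) by (simp only: mult_minus_left mult_minus_right)
        then show ?thesis using s(1) by (simp only: mult_less_cancel_left_pos)
      qed
      moreover have "\<bar>h (R x k \<omega>)\<bar> \<le> B" using B x by simp
      ultimately have "\<bar>ln (cmod (R x k \<omega>)) - L * real k\<bar> \<le> 4 * \<epsilon> * real k"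
        using k(2) unfolding u_def abs_le_iff by (simp add: algebra_simps)
      moreover have "ln (cmod (R x k \<omega>)) / real k - L = (ln (cmod (R x k \<omega>)) - L * real k) / real k"
        using k(1) by (simp add: field_simps)
      ultimately show ?case using k(1) by (simp add: abs_divide divide_le_eq)
    qed
  qed
qed

theorem ex_lyapunov_exponent:
  "\<exists>L>0. \<forall>x. x \<noteq> 0 \<longrightarrow> (AE \<omega> in M. (\<lambda>k. ln (cmod (R x k \<omega>)) / real k) \<longlonglongrightarrow> L)"
proof -
  obtain L where L: "L > 0" "\<And>\<epsilon>. \<epsilon> > 0 \<Longrightarrow> \<exists>n. \<forall>x. x \<noteq> 0 \<longrightarrow> \<bar>(Q ^^ n) drift x - L\<bar> \<le> \<epsilon>"
    using ex_lyapunov_limit by blast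
  have "AE \<omega> in M. (\<lambda>k. ln (cmod (R x k \<omega>)) / real k) \<longlonglongrightarrow> L" if x: "x \<noteq> 0" for x
  proof -
    have "AE \<omega> in M. \<forall>\<^sub>F k in sequentially. \<bar>ln (cmod (R x k \<omega>)) / real k - L\<bar> \<le> 4 * inverse (real (Suc m))" for m
    proof -
      have pos: "inverse (real (Suc m)) > 0" by simp
      then obtain n where "\<And>x. x \<noteq> 0 \<Longrightarrow> \<bar>(Q ^^ n) drift x - L\<bar> \<le> inverse (real (Suc m))" using L(2) by blast
      from AE_R_growth[OF x pos this] show ?thesis .
    qed
    then have "AE \<omega> in M. \<forall>m. \<forall>\<^sub>F k in sequentially. \<bar>ln (cmod (R x k \<omega>)) / real k - L\<bar> \<le> 4 * inverse (real (Suc m))"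
      by (simp add: AE_all_countable)
    then show ?thesis
    proof eventually_elim
      case (elim \<omega>)
      show ?case
      proof (rule tendstoI)
        fix e :: real assume "e > 0"
        then obtain m where m: "inverse (real (Suc m)) < e / 4" using reals_Archimedean[of "e / 4"] by auto
        show "\<forall>\<^sub>F k in sequentially. dist (ln (cmod (R x k \<omega>)) / real k) L < e"
          using elim[rule_format, of m] by eventually_elim (use m in \<open>simp add: dist_real_def\<close>)
      qed
    qed
  qed
  then show ?thesis using L(1) by blast
qed

end

section \<open>Transfer matrices\<close>

lemma quadratic_roots:
  fixes a b c :: real
  assumes "a \<noteq> 0 \<or> b \<noteq> 0 \<or> c \<noteq> 0"
  shows "finite {l. c + b * l + a * l\<^sup>2 = 0} \<and> card {l. c + b * l + a * l\<^sup>2 = 0} \<le> 2"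
proof -
  let ?p = "[:c, b, a:]"
  have p: "?p \<noteq> 0" using assms by auto
  have eq: "{l. c + b * l + a * l\<^sup>2 = 0} = {l. poly ?p l = 0}"
    by (simp add: power2_eq_square algebra_simps)
  have "degree ?p \<le> 2" by simp
  then show ?thesis unfolding eq using poly_roots_finite[OF p] card_poly_roots_bound[OF p] by linarith
qed

definition emb :: "complex \<Rightarrow> real^2" where
  "emb z = vector [Re z, Im z]"

lemma norm_emb: "norm (emb z) = cmod z"
  by (simp add: emb_def norm_vec_def L2_set_def sum_2 cmod_def)

text \<open>The two-step transfer matrix in complex coordinates, with the factor of
  \<open>f0\<close> acting first.\<close>

definition step :: "real \<Rightarrow> real \<Rightarrow> real \<Rightarrow> real \<Rightarrow> complex \<Rightarrow> complex" where
  "step f0 f1 E l z = Complex (((E - f0 * l) * (E - f1 * l) - 1) * Re z - (E - f1 * l) * Im z)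
     ((E - f0 * l) * Re z - Im z)"

lemma transfer_emb: "transfer f l E *v emb z = emb (Complex ((E - f * l) * Re z - Im z) (Re z))"
  by (simp add: transfer_def emb_def matrix_vector_mult_def vec_eq_iff forall_2 sum_2)

lemma block_transfer_emb: "block_transfer [f0, f1] l E *v emb z = emb (step f0 f1 E l z)"
  by (simp add: block_transfer_def matrix_vector_mul_assoc[symmetric] transfer_emb step_def algebra_simps)

text \<open>The operator norm is comparable to the lengths of the images of two basis vectors, so
  two walks determine its growth.\<close>

lemma mnorm_bounds:
  shows "norm (P *v emb z) \<le> mnorm P * cmod z"
    and "mnorm P \<le> norm (P *v emb 1) + norm (P *v emb \<i>)"
proof -
  show "norm (P *v emb z) \<le> mnorm P * cmod z"
    using onorm[OF matrix_vector_mul_bounded_linear[of P], of "emb z"] by (simp add: mnorm_def norm_emb)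
  show "mnorm P \<le> norm (P *v emb 1) + norm (P *v emb \<i>)"
    unfolding mnorm_def
  proof (rule onorm_bound)
    fix v :: "real^2"
    have v: "v = v $ 1 *\<^sub>R emb 1 + v $ 2 *\<^sub>R emb \<i>"
      by (simp add: vec_eq_iff forall_2 emb_def)
    have "P *v v = v $ 1 *\<^sub>R (P *v emb 1) + v $ 2 *\<^sub>R (P *v emb \<i>)"
      by (subst v) (simp only: matrix_vector_right_distrib matrix_vector_mult_scaleR)
    then have "norm (P *v v) \<le> \<bar>v $ 1\<bar> * norm (P *v emb 1) + \<bar>v $ 2\<bar> * norm (P *v emb \<i>)"
      using norm_triangle_ineq[of "v $ 1 *\<^sub>R (P *v emb 1)" "v $ 2 *\<^sub>R (P *v emb \<i>)"] by simp
    also have "\<dots> \<le> norm v * norm (P *v emb 1) + norm v * norm (P *v emb \<i>)"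
      by (intro add_mono mult_right_mono component_le_norm_cart) auto
    finally show "norm (P *v v) \<le> (norm (P *v emb 1) + norm (P *v emb \<i>)) * norm v"
      by (simp add: algebra_simps)
  qed auto
qed

lemma irreducible_step:
  assumes f: "f0 > 0" "f1 > 0" and S: "infinite S \<or> card S \<ge> 5"
  shows "\<exists>l\<in>S. \<exists>x. qform q (step f0 f1 E l x) \<noteq> qform q x"
    and "x \<noteq> 0 \<Longrightarrow> y \<noteq> 0 \<Longrightarrow> \<exists>l\<in>S. wedge x (step f0 f1 E l x) \<noteq> 0 \<and> wedge x (step f0 f1 E l y) \<noteq> 0"
proof -
  have not_sub: "\<not> S \<subseteq> F" if "finite F" "card F \<le> 4" for F
    using S that card_mono[OF that(1), of S] finite_subset[of S F] by auto
  show "\<exists>l\<in>S. \<exists>x. qform q (step f0 f1 E l x) \<noteq> qform q x"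
  proof (rule ccontr)
    assume "\<not> ?thesis"
    \<comment> \<open>The vector \<open>\<i>\<close> suffices: invariance there is a quadratic
      equation in \<open>E - f1 * l\<close> with leading coefficient
      \<open>p + Re q > 0\<close>.\<close>
    then have inv: "qform q (step f0 f1 E l \<i>) = qform q \<i>" if "l \<in> S" for l using that by blast
    define p where "p = sqrt (1 + (cmod q)\<^sup>2)"
    have "p + Re q > 0" using sqrt_norm_bounds(1)[of q] abs_Re_le_cmod[of q] unfolding p_def by linarith
    have "(p + Re q) * (E - f1 * l)\<^sup>2 - 2 * Im q * (E - f1 * l) = 0" if "l \<in> S" for l
      using inv[OF that] unfolding qform_def p_def[symmetric]
      by (simp add: step_def cmod_power2) (simp add: power2_eq_square algebra_simps)
    then have "S \<subseteq> {l. ((p + Re q) * E\<^sup>2 - 2 * Im q * E) + (2 * Im q * f1 - 2 * (p + Re q) * E * f1) * l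
        + ((p + Re q) * f1\<^sup>2) * l\<^sup>2 = 0}" (is "_ \<subseteq> ?F")
      by (auto simp: power2_eq_square algebra_simps)
    moreover have "finite ?F \<and> card ?F \<le> 2"
      using \<open>p + Re q > 0\<close> f by (intro quadratic_roots) auto
    ultimately show False using not_sub[of ?F] by linarith
  qed
  have roots: "finite {l. wedge x (step f0 f1 E l y) = 0} \<and> card {l. wedge x (step f0 f1 E l y) = 0} \<le> 2"
    if xy: "x \<noteq> 0" "y \<noteq> 0" for x y
  proof -
    define c2 where "c2 = - (Im x * Re y * f0 * f1)"
    define c1 where "c1 = - (f0 * Re x * Re y) + Im x * Re y * E * (f0 + f1) - Im x * Im y * f1"
    define c0 where "c0 = Re x * (E * Re y - Im y) - Im x * ((E\<^sup>2 - 1) * Re y - E * Im y)"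
    have "wedge x (step f0 f1 E l y) = c0 + c1 * l + c2 * l\<^sup>2" for l
      by (simp add: wedge_def step_def c0_def c1_def c2_def power2_eq_square algebra_simps)
    \<comment> \<open>The leading coefficient vanishes only if \<open>Im x = 0\<close> or
      \<open>Re y = 0\<close>; in either case the other two coefficients force \<open>y = 0\<close>
      or \<open>x = 0\<close>.\<close>
    moreover have "c2 \<noteq> 0 \<or> c1 \<noteq> 0 \<or> c0 \<noteq> 0"
    proof (rule ccontr)
      assume "\<not> ?thesis"
      then have z: "c2 = 0" "c1 = 0" "c0 = 0" by auto
      have "Im x = 0 \<or> Re y = 0" using z(1) f by (simp add: c2_def)
      then show False
      proof
        assume "Im x = 0"
        moreover from this have "Re x \<noteq> 0" using xy(1) by (simp add: complex_eq_iff)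
        ultimately have "Re y = 0" "Im y = 0" using z f by (simp_all add: c1_def c0_def)
        then show False using xy(2) by (simp add: complex_eq_iff)
      next
        assume "Re y = 0"
        moreover from this have "Im y \<noteq> 0" using xy(2) by (simp add: complex_eq_iff)
        ultimately have "Im x = 0" "Re x = 0" using z f by (simp_all add: c1_def c0_def)
        then show False using xy(1) by (simp add: complex_eq_iff)
      qed
    qed
    ultimately show ?thesis using quadratic_roots[of c2 c1 c0] by simp
  qed
  show "\<exists>l\<in>S. wedge x (step f0 f1 E l x) \<noteq> 0 \<and> wedge x (step f0 f1 E l y) \<noteq> 0" if "x \<noteq> 0" "y \<noteq> 0"
  proof -
    let ?F = "{l. wedge x (step f0 f1 E l x) = 0}" and ?G = "{l. wedge x (step f0 f1 E l y) = 0}"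
    \<comment> \<open>Two quadratics exclude at most four points, so a fifth one in the support is
      enough.\<close>
    have "card (?F \<union> ?G) \<le> 4" using card_Un_le[of ?F ?G] roots[of x x] roots[of x y] that by linarith
    moreover have "finite (?F \<union> ?G)" using roots that by simp
    ultimately have "\<not> S \<subseteq> ?F \<union> ?G" using not_sub by blast
    then show ?thesis by blast
  qed
qed

theorem mainTheorem12:
  fixes f0 f1 :: real and \<nu> :: "real measure"
    and M :: "'a measure" and lam :: "nat \<Rightarrow> 'a \<Rightarrow> real"
  assumes f0: "f0 > 0" and f1: "f1 > 0"
    and nu_prob: "prob_space \<nu>" and nu_sets: "sets \<nu> = sets borel"
    and nu_cpt: "compact (msupp \<nu>)"
    and nu_card: "infinite (msupp \<nu>) \<or> card (msupp \<nu>) \<ge> 5"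
    and M_prob: "prob_space M"
    and indep: "prob_space.indep_vars M (\<lambda>_. borel) lam UNIV"
    and law: "\<And>i. distr M borel (lam i) = \<nu>"
  shows "\<forall>E::real. \<exists>L>0. AE \<omega> in M.
           (\<lambda>n. ln (mnorm (rand_prod [f0, f1] (\<lambda>i. lam i \<omega>) E n)) / real n) \<longlonglongrightarrow> L"
proof
  fix E :: real
  interpret F: sl2_family \<nu> "step f0 f1 E"
  proof (rule sl2_family.intro[OF nu_prob nu_sets nu_cpt])
    show "linear (step f0 f1 E l)" for l
      by (rule linearI) (simp_all add: step_def complex_eq_iff algebra_simps)
    show "wedge (step f0 f1 E l x) (step f0 f1 E l y) = wedge x y" for l x y
      by (simp add: step_def wedge_def algebra_simps)
    show "continuous_on UNIV (\<lambda>p. step f0 f1 E (fst p) (snd p))"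
      unfolding step_def by (intro continuous_intros)
  qed
  interpret M: prob_space M by (rule M_prob)
  interpret irreducible_sl2_random_walk \<nu> "step f0 f1 E" M lam
    by unfold_locales (use indep law irreducible_step[OF f0 f1 nu_card] in auto)
  have prod_emb: "rand_prod [f0, f1] s E n *v emb z = emb (F.walk s z n)" for s n z
    by (induction n) (simp_all add: matrix_vector_mul_assoc[symmetric] block_transfer_emb)
  obtain L where L: "L > 0" and
    lim: "\<And>x. x \<noteq> 0 \<Longrightarrow> AE \<omega> in M. (\<lambda>k. ln (cmod (R x k \<omega>)) / real k) \<longlonglongrightarrow> L"
    using ex_lyapunov_exponent by blast
  have "AE \<omega> in M. (\<lambda>n. ln (mnorm (rand_prod [f0, f1] (\<lambda>i. lam i \<omega>) E n)) / real n) \<longlonglongrightarrow> L"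
    using lim[of 1, OF one_neq_zero] lim[of \<i>, OF complex_i_not_zero]
  proof eventually_elim
    case (elim \<omega>)
    define w1 where "w1 n = cmod (R 1 n \<omega>)" for n
    define w2 where "w2 n = cmod (R \<i> n \<omega>)" for n
    define N where "N n = mnorm (rand_prod [f0, f1] (\<lambda>i. lam i \<omega>) E n)" for n
    have pos: "w1 n > 0" "w2 n > 0" for n by (simp_all add: w1_def w2_def)
    have lo: "w1 n \<le> N n" for n
      using mnorm_bounds(1)[of "rand_prod [f0, f1] (\<lambda>i. lam i \<omega>) E n" 1]
      by (simp add: prod_emb norm_emb w1_def N_def)
    \<comment> \<open>The two walks share the limit \<open>L\<close>, so the maximum and the factor
      2 disappear after division by \<open>n\<close>.\<close>
    have up: "N n \<le> 2 * max (w1 n) (w2 n)" for n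
      using mnorm_bounds(2)[of "rand_prod [f0, f1] (\<lambda>i. lam i \<omega>) E n"]
      by (simp add: prod_emb norm_emb w1_def w2_def N_def)
    have ln_up: "ln (N n) / real n \<le> ln 2 / real n + max (ln (w1 n) / real n) (ln (w2 n) / real n)" for n
    proof -
      have "ln (N n) \<le> ln (2 * max (w1 n) (w2 n))" using up[of n] lo[of n] pos[of n] by (intro ln_mono) auto
      also have "\<dots> = ln 2 + ln (max (w1 n) (w2 n))" using pos[of n] by (intro ln_mult_pos) auto
      also have "ln (max (w1 n) (w2 n)) = max (ln (w1 n)) (ln (w2 n))"
        using pos[of n] by (auto simp: max_def)
      finally have "ln (N n) / real n \<le> (ln 2 + max (ln (w1 n)) (ln (w2 n))) / real n"
        by (intro divide_right_mono) auto
      then show ?thesis by (simp add: add_divide_distrib max_divide_distrib_right)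
    qed
    have ln_lo: "ln (w1 n) / real n \<le> ln (N n) / real n" for n
      using lo[of n] pos[of n] by (intro divide_right_mono ln_mono) auto
    have l1: "(\<lambda>n. ln (w1 n) / real n) \<longlonglongrightarrow> L" and l2: "(\<lambda>n. ln (w2 n) / real n) \<longlonglongrightarrow> L"
      using elim by (simp_all add: w1_def w2_def)
    have "(\<lambda>n. ln 2 / real n + max (ln (w1 n) / real n) (ln (w2 n) / real n)) \<longlonglongrightarrow> 0 + max L L"
      by (intro tendsto_add tendsto_max l1 l2 lim_const_over_n)
    then have l3: "(\<lambda>n. ln 2 / real n + max (ln (w1 n) / real n) (ln (w2 n) / real n)) \<longlonglongrightarrow> L" by simp
    have "(\<lambda>n. ln (N n) / real n) \<longlonglongrightarrow> L"
      by (rule tendsto_sandwich[OF _ _ l1 l3]) (use ln_lo ln_up in auto)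
    then show ?case by (simp add: N_def)
  qed
  then show "\<exists>L>0. AE \<omega> in M.
      (\<lambda>n. ln (mnorm (rand_prod [f0, f1] (\<lambda>i. lam i \<omega>) E n)) / real n) \<longlonglongrightarrow> L"
    using L by blast
qed

end
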